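(* Let $p\in\mathbb{C}$ with $\Re(p)>0$ and let $\gamma>0$ be real. Then $$S_{\frac12,p}(\gamma)=-4\gamma\sum_{k\ge1}\frac{\partial^3}{\partial q^3}\left(\frac{J_1\left(\sqrt{2p}\,[\sqrt{q^2+\gamma^2}-q]^{\frac12}\right)K_0\left(\sqrt{2p}\,[\sqrt{q^2+\gamma^2}+q]^{\frac12}\right)}{\sqrt{2p}\,[\sqrt{q^2+\gamma^2}+q]^{\frac12}}+\frac{J_0\left(\sqrt{2p}\,[\sqrt{q^2+\gamma^2}-q]^{\frac12}\right)K_1\left(\sqrt{2p}\,[\sqrt{q^2+\gamma^2}+q]^{\frac12}\right)}{\sqrt{2p}\,[\sqrt{q^2+\gamma^2}-q]^{\frac12}}\right)\Bigg|_{q=k}.$$ Moreover, $$S_{-\frac12,p}(\gamma)=4\gamma\sum_{k\ge1}\frac{\partial}{\partial q}\left(J_1\left(\sqrt{2p}\,[\sqrt{q^2+\gamma^2}-q]^{\frac12}\right)K_1\left(\sqrt{2p}\,[\sqrt{q^2+\gamma^2}+q]^{\frac12}\right)\right)\Big|_{q=k}.$$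
   Context: $J_\nu$ is the Bessel function of the first kind and $K_\nu$ the modified Bessel function of the second kind; all roots are principal. The $p$-extended Mathieu series is $S_{\mu,p}(r)=2\sum_{n\ge0}(-1)^n r^{2n}\binom{\mu+n}{n}\zeta_p(2\mu+2n+1)$, where $\zeta_p(s)=\frac1{\Gamma(s)}\int_0^\infty\frac{t^{s-1}e^{-p/t}}{e^t-1}\,dt$ is the $p$-extended Riemann zeta function. For all $r>0$, $\mu>-1$ and $\Re(p)>0$ it is understood through its integral form $$S_{\mu,p}(r)=\frac{\sqrt\pi}{(2r)^{\mu-\frac12}\Gamma(\mu+1)}\int_0^\infty\frac{t^{\mu+\frac12}e^{-p/t}}{e^t-1}J_{\mu-\frac12}(rt)\,dt .$$ *)

theory Defs
  imports "HOL-Analysis.Analysis"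
begin

text \<open>
  Bessel functions of real order and complex argument, on the principal branch.
  Using the entire function \<^const>\<open>rGamma\<close> keeps the power series meaningful at negative integer
  orders, where the first terms vanish.  The case distinction is needed only at \<open>z = 0\<close>, since
  \<open>0 powr 0 = 0\<close> for complex numbers.
\<close>

definition Bessel_J :: "real \<Rightarrow> complex \<Rightarrow> complex" where
  "Bessel_J \<nu> z = (if \<nu> = 0 then 1 else (z / 2) powr of_real \<nu>) *
     (\<Sum>m. (-1) ^ m * rGamma (of_real \<nu> + of_nat m + 1) / fact m * (z / 2) ^ (2 * m))"

definition Bessel_I :: "real \<Rightarrow> complex \<Rightarrow> complex" where
  "Bessel_I \<nu> z = (if \<nu> = 0 then 1 else (z / 2) powr of_real \<nu>) *
     (\<Sum>m. rGamma (of_real \<nu> + of_nat m + 1) / fact m * (z / 2) ^ (2 * m))"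

text \<open>
  The function \<open>K\<close> at an integer order is the limit of its values at neighbouring orders.
\<close>

definition Bessel_K :: "real \<Rightarrow> complex \<Rightarrow> complex" where
  "Bessel_K \<nu> z =
     (let f = (\<lambda>\<mu>. of_real pi / 2 * (Bessel_I (-\<mu>) z - Bessel_I \<mu> z) / of_real (sin (\<mu> * pi)))
      in if \<nu> \<in> \<int> then Lim (at \<nu>) f else f \<nu>)"

text \<open>
  The \<open>p\<close>-extended Mathieu series, given by its integral form; this is meaningful for
  \<open>\<mu> > -1\<close>, \<open>Re p > 0\<close> and \<open>r > 0\<close>.
\<close>

definition ext_Mathieu :: "real \<Rightarrow> complex \<Rightarrow> real \<Rightarrow> complex" where
  "ext_Mathieu \<mu> p r =
     of_real (sqrt pi / ((2 * r) powr (\<mu> - 1/2) * Gamma (\<mu> + 1))) *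
     (LINT t:{0<..}|lborel.
        of_real (t powr (\<mu> + 1/2)) * exp (- p / of_real t) / of_real (exp t - 1) *
        Bessel_J (\<mu> - 1/2) (of_real (r * t)))"

end

theory Submission
  imports Defs "HOL-Complex_Analysis.Conformal_Mappings"
begin

text \<open>
  The series come from expanding \<open>1/(e\<^sup>t - 1) = \<Sum>\<^sub>k e\<^bsup>-kt\<^esup>\<close>, \<open>k \<ge> 1\<close>, in the integrals that define \<open>S\<close>.  Up to constants, for \<open>\<mu> = 1/2\<close>
  and \<open>\<mu> = -1/2\<close> the summands are \<open>\<integral> t e\<^bsup>-kt-p/t\<^esup> J\<^sub>0(\<gamma>t) dt\<close> and \<open>\<integral> e\<^bsup>-kt-p/t\<^esup> J\<^bsub>-1\<^esub>(\<gamma>t) dt\<close> with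
  \<open>J\<^bsub>-1\<^esub> = - J\<^sub>1\<close>, that is, derivatives at \<open>q = k\<close> of the transforms

    \<open>\<Phi>\<^sub>\<nu>(q) = \<integral> t\<^bsup>-1\<^esup> e\<^bsup>-qt-p/t\<^esup> J\<^sub>\<nu>(\<gamma>t) dt = 2 J\<^sub>\<nu>(a) K\<^sub>\<nu>(b)\<close>,   \<open>\<nu> = 0, 1\<close>,

  where \<open>a = 2 \<surd>(px)\<close>, \<open>b = 2 \<surd>(py)\<close> and \<open>y - x = q\<close>, \<open>4xy = \<gamma>\<^sup>2\<close>.  The second function of the theorem is
  \<open>\<Phi>\<^sub>1/2\<close>.  The first one is a primitive of \<open>- \<Phi>\<^sub>0/(2\<gamma>)\<close>; this is a computation with the
  recurrences of \<open>J\<close> and \<open>K\<close> (\<open>has_field_derivative_J_K_combination\<close>).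

  The product formula for \<open>\<Phi>\<^sub>\<nu>\<close> is the core (\<open>bessel_transform_eq_product\<close>).  In terms of \<open>x\<close> and \<open>y\<close> the
  integrand contains \<open>e\<^bsup>xt\<^esup> J\<^sub>\<nu>(2t \<surd>(xy))\<close>, which is a generating function of Laguerre polynomials in \<open>yt\<close>, with
  expansion parameter \<open>xt\<close>.  The integral of the \<open>n\<close>-th Laguerre polynomial against \<open>t\<^bsup>n+\<nu>-1\<^esup> e\<^bsup>-yt-p/t\<^esup>\<close>
  is an explicit multiple of \<open>(- p)\<^sup>n \<integral> t\<^bsup>\<nu>-1\<^esup> e\<^bsup>-yt-p/t\<^esup> dt\<close>, by \<open>n\<close> integrations by parts; summing over
  \<open>n\<close> gives the power series of \<open>J\<^sub>\<nu>(a)\<close> times this last integral.  Term-by-term integration is legitimate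
  when \<open>x\<close> is small against \<open>y\<close>, that is, for large \<open>q\<close>; since \<open>J\<^sub>0\<close> and \<open>J\<^sub>1\<close> are bounded on the real line
  (\<open>norm_Bessel_J_0_1_bound\<close>), both sides are holomorphic for \<open>Re q > 0\<close> and the identity continues there.

  It remains to recognize \<open>\<integral> t\<^bsup>-\<mu>-1\<^esup> e\<^bsup>-yt-p/t\<^esup> dt\<close> as a multiple of \<open>K\<^sub>\<mu>(2 \<surd>(py))\<close>, where \<open>K\<close> is defined through
  \<open>I\<^bsub>-\<mu>\<^esub> - I\<^sub>\<mu>\<close>.  At non-integer order the integral and the two power series solve the same linear system
  in \<open>y\<close>; the linear relation between the three solutions has the Wronskians as coefficients, and
  these are constants that can be evaluated at the singular point \<open>y = 0\<close>
  (\<open>macdonald_integral_conv_bessel_clifford\<close>).  Continuity in \<open>\<mu>\<close> then yields \<open>K\<^sub>0\<close> and \<open>K\<^sub>1\<close>.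
\<close>

section \<open>Bessel--Clifford functions\<close>

text \<open>
  Both \<open>J\<^sub>\<mu> z\<close> and \<open>I\<^sub>\<mu> z\<close> are \<open>(z/2)\<^sup>\<mu>\<close> times this entire function, taken at
  \<open>- (z/2)\<^sup>2\<close> and \<open>(z/2)\<^sup>2\<close>: it isolates the part without a branch, and
  differentiating it merely raises the order by one.
\<close>

definition bessel_clifford :: "real \<Rightarrow> complex \<Rightarrow> complex" where
  "bessel_clifford \<mu> w = (\<Sum>m. rGamma (of_real \<mu> + of_nat m + 1) / fact m * w ^ m)"

lemma summable_bessel_clifford:
  "summable (\<lambda>m. rGamma (of_real \<mu> + of_nat m + 1) / fact m * (w::complex) ^ m)"
proof -
  obtain N :: nat where N: "real N \<ge> 2 * norm w + \<bar>\<mu>\<bar>"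
    using real_arch_simple by blast
  let ?f = "\<lambda>m. rGamma (of_real \<mu> + of_nat m + 1) / fact m * (w::complex) ^ m"
  show ?thesis
  proof (rule summable_ratio_test[where c = "1/2" and N = N])
    fix n assume n: "n \<ge> N"
    have pos: "\<mu> + real n + 1 \<ge> 1" "real n + 1 \<ge> 2 * norm w"
    proof -
      have "real n \<ge> 2 * norm w + \<bar>\<mu>\<bar>" using N n by linarith
      thus "\<mu> + real n + 1 \<ge> 1" "real n + 1 \<ge> 2 * norm w"
        using norm_ge_zero[of w] by linarith+
    qed
    have rG: "(of_real \<mu> + of_nat n + 1) * rGamma (of_real \<mu> + of_nat n + 1 + 1 :: complex)
            = rGamma (of_real \<mu> + of_nat n + 1)"
      by (rule rGamma_plus1)
    have nrm: "norm (of_real \<mu> + of_nat n + 1 :: complex) = \<mu> + real n + 1"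
    proof -
      have "(of_real \<mu> + of_nat n + 1 :: complex) = of_real (\<mu> + real n + 1)" by simp
      thus ?thesis using pos(1) by (simp only: norm_of_real)
    qed
    have le: "norm (rGamma (of_real \<mu> + of_nat n + 1 + 1 :: complex))
            \<le> norm (rGamma (of_real \<mu> + of_nat n + 1 :: complex))"
      unfolding rG[symmetric] norm_mult nrm using pos(1)
      by (simp add: mult_le_cancel_right1 del: of_real_add)
    have e: "of_real \<mu> + of_nat (Suc n) + 1 = (of_real \<mu> + of_nat n + 1 + 1 :: complex)"
      by simp
    have "norm (?f (Suc n)) = norm (rGamma (of_real \<mu> + of_nat n + 1 + 1 :: complex)) / fact n * norm w ^ n
            * (norm w / real (Suc n))"
      unfolding e fact_Suc by (simp add: norm_mult norm_divide norm_power mult_ac del: of_nat_Suc)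
    also have "\<dots> \<le> norm (rGamma (of_real \<mu> + of_nat n + 1 :: complex)) / fact n * norm w ^ n * (1/2)"
      using le pos(2) by (intro mult_mono divide_right_mono) (auto simp: field_simps)
    also have "\<dots> = 1/2 * norm (?f n)"
      by (simp add: norm_mult norm_divide norm_power)
    finally show "norm (?f (Suc n)) \<le> 1/2 * norm (?f n)" .
  qed auto
qed

lemma has_field_derivative_bessel_clifford:
  "(bessel_clifford \<mu> has_field_derivative bessel_clifford (\<mu> + 1) w) (at w)"
proof -
  let ?c = "\<lambda>m. rGamma (of_real \<mu> + of_nat m + 1) / fact m :: complex"
  have "((\<lambda>x. \<Sum>n. ?c n * x ^ n) has_field_derivative (\<Sum>n. diffs ?c n * w ^ n)) (at w)"
    by (rule termdiffs_strong_converges_everywhere) (rule summable_bessel_clifford)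
  moreover have "diffs ?c = (\<lambda>n. rGamma (of_real (\<mu> + 1) + of_nat n + 1) / fact n)"
  proof
    fix n
    have "of_real (\<mu> + 1) + of_nat n + 1 = (of_real \<mu> + of_nat (Suc n) + 1 :: complex)" by simp
    thus "diffs ?c n = rGamma (of_real (\<mu> + 1) + of_nat n + 1) / fact n"
      by (simp add: diffs_def fact_Suc del: of_nat_Suc of_real_add)
  qed
  ultimately show ?thesis
    by (simp add: bessel_clifford_def[abs_def])
qed

lemmas has_field_derivative_bessel_clifford' [derivative_intros] =
  DERIV_chain2[OF has_field_derivative_bessel_clifford]

lemma continuous_on_bessel_clifford [continuous_intros]:
  assumes "continuous_on S f"
  shows "continuous_on S (\<lambda>x. bessel_clifford \<mu> (f x))"
proof -
  have "continuous_on UNIV (bessel_clifford \<mu>)"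
    by (rule DERIV_continuous_on) (rule has_field_derivative_at_within[OF has_field_derivative_bessel_clifford])
  thus ?thesis using assms continuous_on_compose2 by blast
qed

lemma isCont_bessel_clifford: "isCont (bessel_clifford \<mu>) w"
  using has_field_derivative_bessel_clifford DERIV_isCont by blast

lemma measurable_bessel_clifford [measurable]: "bessel_clifford \<mu> \<in> borel_measurable borel"
  by (intro borel_measurable_continuous_onI continuous_intros)

lemma bessel_clifford_0: "bessel_clifford \<mu> 0 = rGamma (of_real \<mu> + 1)"
  unfolding bessel_clifford_def using powser_zero[of "\<lambda>m. rGamma (of_real \<mu> + of_nat m + 1) / fact m :: complex"]
  by simp

text \<open>
  Coefficient by coefficient this is the functional equation of \<open>1/\<Gamma>\<close>.  Since the derivative
  raises the order, it is also the differential equation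
  \<open>w E'' + (\<mu> + 1) E' = E\<close> of \<open>E = bessel_clifford \<mu>\<close> (shift \<open>\<mu>\<close> by one), and it is used in place of
  Bessel's equation throughout.
\<close>

lemma bessel_clifford_recurrence:
  "w * bessel_clifford (\<mu> + 1) w + of_real \<mu> * bessel_clifford \<mu> w = bessel_clifford (\<mu> - 1) w"
proof -
  let ?c = "\<lambda>m. rGamma (of_real \<mu> + of_nat m + 1) / fact m :: complex"
  have "(\<lambda>m. w * (rGamma (of_real (\<mu> + 1) + of_nat m + 1) / fact m * w ^ m)) sums (w * bessel_clifford (\<mu> + 1) w)"
    unfolding bessel_clifford_def by (intro sums_mult summable_sums summable_bessel_clifford)
  also have "(\<lambda>m. w * (rGamma (of_real (\<mu> + 1) + of_nat m + 1) / fact m * w ^ m)) =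
             (\<lambda>m. of_nat (Suc m) * ?c (Suc m) * w ^ Suc m)"
  proof
    fix m
    have "of_real (\<mu> + 1) + of_nat m + 1 = (of_real \<mu> + of_nat (Suc m) + 1 :: complex)" by simp
    thus "w * (rGamma (of_real (\<mu> + 1) + of_nat m + 1) / fact m * w ^ m) =
          of_nat (Suc m) * ?c (Suc m) * w ^ Suc m"
      by (simp add: fact_Suc del: of_nat_Suc of_real_add)
  qed
  finally have 1: "(\<lambda>m. of_nat m * ?c m * w ^ m) sums (w * bessel_clifford (\<mu> + 1) w)"
    using sums_Suc_iff[of "\<lambda>m. of_nat m * ?c m * w ^ m" "w * bessel_clifford (\<mu> + 1) w"] by simp
  have 2: "(\<lambda>m. of_real \<mu> * (?c m * w ^ m)) sums (of_real \<mu> * bessel_clifford \<mu> w)"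
    unfolding bessel_clifford_def by (intro sums_mult summable_sums summable_bessel_clifford)
  have "(\<lambda>m. of_nat m * ?c m * w ^ m + of_real \<mu> * (?c m * w ^ m)) =
        (\<lambda>m. rGamma (of_real (\<mu> - 1) + of_nat m + 1) / fact m * w ^ m)"
  proof
    fix m
    have 1: "(of_real \<mu> + of_nat m) * rGamma (of_real \<mu> + of_nat m + 1 :: complex) = rGamma (of_real \<mu> + of_nat m)"
      by (rule rGamma_plus1)
    have 2: "of_real (\<mu> - 1) + of_nat m + 1 = (of_real \<mu> + of_nat m :: complex)"
      by simp
    show "of_nat m * ?c m * w ^ m + of_real \<mu> * (?c m * w ^ m) =
        rGamma (of_real (\<mu> - 1) + of_nat m + 1) / fact m * w ^ m"
      unfolding 2 1[symmetric] by (simp add: field_simps)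
  qed
  with sums_add[OF 1 2] show ?thesis
    by (simp add: bessel_clifford_def sums_iff)
qed

lemma Bessel_J_conv_bessel_clifford:
  "Bessel_J \<nu> z = (if \<nu> = 0 then 1 else (z / 2) powr of_real \<nu>) * bessel_clifford \<nu> (- ((z / 2)\<^sup>2))"
proof -
  have "(-1) ^ m * (x::complex) / fact m * (z / 2) ^ (2 * m) = x / fact m * (- ((z / 2)\<^sup>2)) ^ m" for m x
    by (simp add: power_mult power_minus[of "(z/2)\<^sup>2"])
  thus ?thesis unfolding Bessel_J_def bessel_clifford_def by (simp only:)
qed

lemma Bessel_I_conv_bessel_clifford:
  "Bessel_I \<nu> z = (if \<nu> = 0 then 1 else (z / 2) powr of_real \<nu>) * bessel_clifford \<nu> ((z / 2)\<^sup>2)"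
  unfolding Bessel_I_def bessel_clifford_def by (simp add: power_mult)

lemma Bessel_J_0: "Bessel_J 0 z = bessel_clifford 0 (- ((z / 2)\<^sup>2))"
  by (simp add: Bessel_J_conv_bessel_clifford)

lemma Bessel_J_1: "Bessel_J 1 z = z / 2 * bessel_clifford 1 (- ((z / 2)\<^sup>2))"
  by (simp add: Bessel_J_conv_bessel_clifford)

lemma Bessel_J_minus_1: "Bessel_J (-1) z = - Bessel_J 1 z"
proof (cases "z = 0")
  case False
  have "bessel_clifford (-1) w = w * bessel_clifford 1 w" for w
    using bessel_clifford_recurrence[of w 0] by simp
  moreover have "(z / 2) powr (-1) = 2 / z"
    by (simp add: powr_minus)
  ultimately show ?thesis using False
    by (simp add: Bessel_J_conv_bessel_clifford power2_eq_square)
qed (simp add: Bessel_J_conv_bessel_clifford)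

text \<open>
  The power series only bounds \<open>J\<close> by an exponential, which is useless for \<open>\<integral> e\<^bsup>-qt\<^esup> J\<^sub>\<nu>(\<gamma>t) \<dots> dt\<close>
  with \<open>q < \<gamma>\<close>.  On the real line the energy \<open>J\<^sub>0\<^sup>2 + J\<^sub>1\<^sup>2\<close> equals \<open>1\<close> at \<open>0\<close> and,
  because \<open>J\<^sub>0' = - J\<^sub>1\<close> and \<open>J\<^sub>1' = J\<^sub>0 - J\<^sub>1/x\<close>, has derivative \<open>- 2 J\<^sub>1\<^sup>2/x \<le> 0\<close>.
\<close>

lemma norm_Bessel_J_0_1_bound:
  assumes "x \<ge> (0::real)"
  shows "(norm (Bessel_J 0 (of_real x)))\<^sup>2 + (norm (Bessel_J 1 (of_real x)))\<^sup>2 \<le> 1"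
proof -
  define f g where "f = (\<lambda>x::real. Bessel_J 0 (of_real x))" and "g = (\<lambda>x::real. Bessel_J 1 (of_real x))"
  have f': "(f has_vector_derivative - g x) (at x)" for x
    unfolding f_def g_def Bessel_J_0 Bessel_J_1
    by (rule has_vector_derivative_real_field)
      (auto intro!: derivative_eq_intros simp: power2_eq_square)
  have g': "(g has_vector_derivative f x - g x / of_real x) (at x)" if "x \<noteq> 0" for x
  proof -
    have E: "bessel_clifford 0 w = w * bessel_clifford 2 w + bessel_clifford 1 w" for w
      using bessel_clifford_recurrence[of w 1] by simp
    show ?thesis
    unfolding f_def g_def Bessel_J_0 Bessel_J_1
    by (rule has_vector_derivative_real_field)
      (use that in \<open>auto intro!: derivative_eq_intros simp: power2_eq_square E field_simps\<close>)
  qed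
  define N where "N = (\<lambda>x. inner (f x) (f x) + inner (g x) (g x))"
  have N': "(N has_real_derivative - 2 * (norm (g x))\<^sup>2 / x) (at x)" if "x > 0" for x
  proof -
    have "(N has_vector_derivative (inner (f x) (- g x) + inner (- g x) (f x)) +
       (inner (g x) (f x - g x / of_real x) + inner (f x - g x / of_real x) (g x))) (at x)"
      unfolding N_def using that
      by (intro has_vector_derivative_add bounded_bilinear.has_vector_derivative[OF bounded_bilinear_inner] f' g') auto
    also have "(inner (f x) (- g x) + inner (- g x) (f x)) +
       (inner (g x) (f x - g x / of_real x) + inner (f x - g x / of_real x) (g x)) = - 2 * (norm (g x))\<^sup>2 / x"
    proof -
      have "g x / of_real x = (1 / x) *\<^sub>R g x" by (simp add: scaleR_conv_of_real)
      thus ?thesis by (simp add: inner_diff_left inner_diff_right inner_commute power2_norm_eq_inner)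
    qed
    finally show ?thesis by (simp add: has_real_derivative_iff_has_vector_derivative)
  qed
  have cont: "continuous_on S N" for S
    unfolding N_def f_def g_def Bessel_J_0 Bessel_J_1 by (intro continuous_intros) auto
  have "N x \<le> N 0"
  proof (cases "x = 0")
    case False
    have "N 0 \<ge> N x"
      by (rule DERIV_nonpos_imp_decreasing_open[of 0 x N])
        (use assms False N' cont in \<open>auto intro!: exI divide_nonpos_pos\<close>)
    thus ?thesis .
  qed simp
  also have "N 0 = 1" by (simp add: N_def f_def g_def Bessel_J_0 Bessel_J_1 bessel_clifford_0)
  finally show ?thesis by (simp add: N_def f_def g_def power2_norm_eq_inner)
qed

lemma norm_Bessel_J_le_1:
  assumes "x \<ge> (0::real)"
  shows "norm (Bessel_J 0 (of_real x)) \<le> 1" "norm (Bessel_J 1 (of_real x)) \<le> 1"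
proof -
  have "(norm (Bessel_J 0 (of_real x)))\<^sup>2 \<le> 1\<^sup>2" "(norm (Bessel_J 1 (of_real x)))\<^sup>2 \<le> 1\<^sup>2"
    using norm_Bessel_J_0_1_bound[OF assms] zero_le_power2[of "norm (Bessel_J 0 (of_real x))"]
      zero_le_power2[of "norm (Bessel_J 1 (of_real x))"]
    unfolding one_power2 by linarith+
  thus "norm (Bessel_J 0 (of_real x)) \<le> 1" "norm (Bessel_J 1 (of_real x)) \<le> 1"
    by (auto intro: power2_le_imp_le)
qed

section \<open>Integrals over the half-line\<close>

text \<open>
  All integrals run over \<open>t > 0\<close>.  Restricting the measure, rather than multiplying
  by an indicator, lets the integrands be manipulated as plain functions.
\<close>

definition pos_lborel :: "real measure" where
  "pos_lborel = restrict_space lborel {0<..}"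

lemma space_pos_lborel: "space pos_lborel = {0<..}"
  by (simp add: pos_lborel_def space_restrict_space)

lemma borel_measurable_pos_lborel [measurable (raw)]:
  "f \<in> borel_measurable borel \<Longrightarrow> f \<in> borel_measurable pos_lborel"
  unfolding pos_lborel_def by (rule measurable_restrict_space1) simp

lemma integrable_pos_lborel_iff:
  fixes f :: "real \<Rightarrow> 'b :: {banach, second_countable_topology}"
  shows "integrable pos_lborel f \<longleftrightarrow> set_integrable lborel {0<..} f"
  by (simp add: pos_lborel_def integrable_restrict_space set_integrable_def)

lemma integral_pos_lborel:
  fixes f :: "real \<Rightarrow> 'b :: {banach, second_countable_topology}"
  shows "integral\<^sup>L pos_lborel f = set_lebesgue_integral lborel {0<..} f"
  by (simp add: pos_lborel_def integral_restrict_space set_lebesgue_integral_def)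

lemma AE_pos_lborel: "(\<And>t. t > 0 \<Longrightarrow> P t) \<Longrightarrow> AE t in pos_lborel. P t"
  using AE_space[of pos_lborel] by (auto simp: space_pos_lborel)

lemma integrable_pos_lborel_bound:
  fixes f :: "real \<Rightarrow> 'b :: {banach, second_countable_topology}"
  assumes "integrable pos_lborel g" "f \<in> borel_measurable borel" "\<And>t. t > 0 \<Longrightarrow> norm (f t) \<le> g t"
  shows "integrable pos_lborel f"
proof (rule Bochner_Integration.integrable_bound[OF assms(1)])
  show "AE t in pos_lborel. norm (f t) \<le> norm (g t)"
  proof (rule AE_pos_lborel)
    fix t :: real assume "t > 0"
    from assms(3)[OF this] show "norm (f t) \<le> norm (g t)" by simp
  qed
qed (use assms(2) in measurable)

lemma integral_pos_lborel_cong: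
  fixes f g :: "real \<Rightarrow> 'b :: {banach, second_countable_topology}"
  assumes "\<And>t. t > 0 \<Longrightarrow> f t = g t"
  shows "integral\<^sup>L pos_lborel f = integral\<^sup>L pos_lborel g"
  by (rule Bochner_Integration.integral_cong) (use assms in \<open>auto simp: space_pos_lborel\<close>)

lemma pos_lborel_dominated_convergence:
  fixes f :: "real \<Rightarrow> 'b :: {banach, second_countable_topology}"
  assumes "f \<in> borel_measurable borel" "\<And>n. s n \<in> borel_measurable borel" "integrable pos_lborel w"
    and "\<And>t. t > 0 \<Longrightarrow> (\<lambda>n. s n t) \<longlonglongrightarrow> f t" "\<And>n t. t > 0 \<Longrightarrow> norm (s n t) \<le> w t"
  shows "(\<lambda>n. integral\<^sup>L pos_lborel (s n)) \<longlonglongrightarrow> integral\<^sup>L pos_lborel f"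
  by (rule integral_dominated_convergence[where w = w])
     (use assms in \<open>auto intro!: AE_pos_lborel borel_measurable_pos_lborel\<close>)

lemma integral_pos_lborel_FTC:
  fixes F f :: "real \<Rightarrow> complex"
  assumes "\<And>t. t > 0 \<Longrightarrow> (F has_vector_derivative f t) (at t)" "\<And>t. t > 0 \<Longrightarrow> isCont f t"
    and "integrable pos_lborel f" "(F \<longlongrightarrow> A) (at_right 0)" "(F \<longlongrightarrow> B) at_top"
  shows "integral\<^sup>L pos_lborel f = B - A"
proof -
  have "(LBINT x=ereal 0..\<infinity>. f x) = B - A"
    by (rule interval_integral_FTC_integrable[where F = F])
       (use assms in \<open>auto simp: ereal_tendsto_simps integrable_pos_lborel_iff\<close>)
  thus ?thesis
    by (simp add: integral_pos_lborel interval_integral_to_infinity_eq)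
qed

lemma integral_pos_lborel_scale:
  fixes f :: "real \<Rightarrow> complex"
  assumes "c > 0"
  shows "integral\<^sup>L pos_lborel f = c *\<^sub>R integral\<^sup>L pos_lborel (\<lambda>t. f (c * t))"
proof -
  have "indicator {0<..} (c * x) = (indicator {0<..} x :: real)" for x
    using assms by (auto simp: indicator_def zero_less_mult_iff)
  thus ?thesis using lborel_integral_real_affine[of c "\<lambda>t. indicator {0<..} t *\<^sub>R f t" 0] assms
    by (simp add: integral_pos_lborel set_lebesgue_integral_def)
qed

lemma exp_integrable_pos_lborel:
  assumes "\<sigma> > 0"
  shows "integrable pos_lborel (\<lambda>t. exp (- (\<sigma> * t)))"
proof -
  have "(\<lambda>t. exp (- \<sigma> * t)) absolutely_integrable_on {0..}"
    by (rule nonnegative_absolutely_integrable_1)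
       (use integrable_on_exp_minus_to_infinity[OF assms, of 0] in auto)
  hence "(\<lambda>t. exp (- \<sigma> * t)) absolutely_integrable_on {0<..}"
    by (rule set_integrable_subset) auto
  hence "set_integrable lborel {0<..} (\<lambda>t. exp (- \<sigma> * t))"
    unfolding set_integrable_def by (subst (asm) integrable_completion) auto
  thus ?thesis by (simp add: integrable_pos_lborel_iff)
qed

text \<open>
  For \<open>m > 0\<close> the logarithm \<open>m ln t\<close> grows more slowly than \<open>\<sigma>t\<close>; for \<open>m < 0\<close> the same argument at
  \<open>1/t\<close> plays \<open>m ln t\<close> off against \<open>\<rho>/t\<close>.
\<close>

lemma powr_mult_exp_bounded:
  fixes m \<rho> \<sigma> :: real
  assumes "\<rho> > 0" "\<sigma> > 0"
  obtains C where "C > 0" "\<And>t. t > 0 \<Longrightarrow> t powr m * exp (- (\<sigma> * t) - \<rho> / t) \<le> C"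
proof -
  have key: "m' * ln u \<le> \<delta> * u - m' * ln (\<delta> / m')" if "m' > 0" "u > 0" "\<delta> > 0" for m' u \<delta> :: real
  proof -
    have "ln (\<delta> / m' * u) \<le> \<delta> / m' * u"
      using ln_le_minus_one[of "\<delta> / m' * u"] that by simp
    hence "m' * ln (\<delta> / m' * u) \<le> m' * (\<delta> / m' * u)"
      by (rule mult_left_mono) (use that in auto)
    also have "ln (\<delta> / m' * u) = ln (\<delta> / m') + ln u"
      by (rule ln_mult_pos) (use that in auto)
    finally show ?thesis using that by (simp add: algebra_simps)
  qed
  have "\<exists>c. \<forall>t>0. m * ln t - \<sigma> * t - \<rho> / t \<le> c"
  proof (cases m "0 :: real" rule: linorder_cases)
    case equal
    thus ?thesis using assms
      by (intro exI[of _ 0] allI impI) (auto intro: order.trans[of _ 0])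
  next
    case greater
    show ?thesis
    proof (intro exI allI impI)
      fix t :: real assume "t > 0"
      with key[of m t \<sigma>] assms greater have "m * ln t \<le> \<sigma> * t - m * ln (\<sigma> / m)" "\<rho> / t > 0" by auto
      thus "m * ln t - \<sigma> * t - \<rho> / t \<le> - m * ln (\<sigma> / m)" by (simp add: algebra_simps)
    qed
  next
    case less
    show ?thesis
    proof (intro exI allI impI)
      fix t :: real assume "t > 0"
      with key[of "-m" "1/t" \<rho>] assms less have "m * ln t \<le> \<rho> / t + m * ln (\<rho> / (-m))" "\<sigma> * t > 0"
        by (auto simp: ln_div)
      thus "m * ln t - \<sigma> * t - \<rho> / t \<le> m * ln (\<rho> / (-m))" by (simp add: algebra_simps)
    qed
  qed
  then obtain c where c: "\<And>t. t > 0 \<Longrightarrow> m * ln t - \<sigma> * t - \<rho> / t \<le> c" by blast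
  show ?thesis
  proof (rule that[of "exp c"])
    fix t :: real assume t: "t > 0"
    have "t powr m * exp (- (\<sigma> * t) - \<rho> / t) = exp (m * ln t - \<sigma> * t - \<rho> / t)"
      using t by (simp add: powr_def flip: exp_add)
    also have "\<dots> \<le> exp c" using c[OF t] by simp
    finally show "t powr m * exp (- (\<sigma> * t) - \<rho> / t) \<le> exp c" .
  qed simp
qed

lemma powr_mult_exp_integrable:
  fixes m \<rho> \<sigma> :: real
  assumes "\<rho> > 0" "\<sigma> > 0"
  shows "integrable pos_lborel (\<lambda>t. t powr m * exp (- (\<sigma> * t) - \<rho> / t))"
proof -
  obtain C where C: "C > 0" "\<And>t. t > 0 \<Longrightarrow> t powr m * exp (- (\<sigma> / 2 * t) - \<rho> / t) \<le> C"
    using powr_mult_exp_bounded[of \<rho> "\<sigma> / 2" m] assms by auto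
  have "integrable pos_lborel (\<lambda>t. C * exp (- (\<sigma> / 2 * t)))"
    by (intro integrable_mult_right exp_integrable_pos_lborel) (use assms in auto)
  thus ?thesis
  proof (rule integrable_pos_lborel_bound)
    fix t :: real assume t: "t > 0"
    have "norm (t powr m * exp (- (\<sigma> * t) - \<rho> / t)) =
      (t powr m * exp (- (\<sigma> / 2 * t) - \<rho> / t)) * exp (- (\<sigma> / 2 * t))"
      by (simp add: mult.assoc flip: exp_add)
    also have "\<dots> \<le> C * exp (- (\<sigma> / 2 * t))"
      by (intro mult_right_mono C t) auto
    finally show "norm (t powr m * exp (- (\<sigma> * t) - \<rho> / t)) \<le> C * exp (- (\<sigma> / 2 * t))" .
  qed measurable
qed

text \<open>
  These limits remove the boundary terms when integrating by parts.  They hold because the bounds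
  for the exponents \<open>m - 1\<close> and \<open>m + 1\<close> leave a factor \<open>t\<close> at \<open>0\<close> and a factor \<open>1/t\<close> at \<open>\<infinity>\<close>.
\<close>

lemma powr_mult_exp_tendsto_0:
  fixes m :: real and p y :: complex
  assumes "Re p > 0" "Re y > 0"
  defines "F \<equiv> \<lambda>t::real. of_real (t powr m) * exp (- (y * of_real t) - p / of_real t)"
  shows "(F \<longlongrightarrow> 0) (at_right 0)" "(F \<longlongrightarrow> 0) at_top"
proof -
  have nF: "norm (F t) = t powr m * exp (- (Re y * t) - Re p / t)" for t
    by (simp add: F_def norm_mult Re_divide_of_real)
  obtain C where C: "C > 0" "\<And>t. t > 0 \<Longrightarrow> t powr (m - 1) * exp (- (Re y * t) - Re p / t) \<le> C"
    using powr_mult_exp_bounded[of "Re p" "Re y" "m - 1"] assms by auto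
  obtain D where D: "D > 0" "\<And>t. t > 0 \<Longrightarrow> t powr (m + 1) * exp (- (Re y * t) - Re p / t) \<le> D"
    using powr_mult_exp_bounded[of "Re p" "Re y" "m + 1"] assms by auto
  have 1: "norm (F t) \<le> C * t" if "t > 0" for t
  proof -
    have "norm (F t) = (t powr (m - 1) * exp (- (Re y * t) - Re p / t)) * t"
      using that by (simp add: nF powr_diff)
    also have "\<dots> \<le> C * t" by (intro mult_right_mono C) (use that in auto)
    finally show ?thesis .
  qed
  have 2: "norm (F t) \<le> D * (1 / t)" if "t > 0" for t
  proof -
    have "norm (F t) = (t powr (m + 1) * exp (- (Re y * t) - Re p / t)) * (1 / t)"
      using that by (simp add: nF powr_add)
    also have "\<dots> \<le> D * (1 / t)" by (intro mult_right_mono D) (use that in auto)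
    finally show ?thesis .
  qed
  show "(F \<longlongrightarrow> 0) (at_right 0)"
  proof (rule Lim_null_comparison)
    show "eventually (\<lambda>t. norm (F t) \<le> C * t) (at_right 0)"
      using eventually_at_right_less[of 0] by eventually_elim (rule 1)
    show "((\<lambda>t. C * t) \<longlongrightarrow> 0) (at_right 0)" by (auto intro!: tendsto_eq_intros)
  qed
  show "(F \<longlongrightarrow> 0) at_top"
  proof (rule Lim_null_comparison)
    show "eventually (\<lambda>t. norm (F t) \<le> D * (1 / t)) at_top"
      using eventually_gt_at_top[of 0] by eventually_elim (rule 2)
    have "((\<lambda>t. D * (1 / t)) \<longlongrightarrow> D * 0) at_top"
      by (intro tendsto_mult tendsto_const tendsto_divide_0[OF tendsto_const] filterlim_at_top_imp_at_infinity filterlim_ident)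
    thus "((\<lambda>t. D * (1 / t)) \<longlongrightarrow> 0) at_top" by simp
  qed
qed

text \<open>
  Taylor's formula gives \<open>e\<^bsup>-hs\<^esup> = 1 - hs + O(h\<^sup>2 s\<^sup>2 e\<^bsup>|h|s\<^esup>)\<close>, and for \<open>|h| < Re z / 4\<close> the factor
  \<open>s\<^sup>2 e\<^bsup>|h|s\<^esup>\<close> is absorbed by part of \<open>e\<^bsup>-zs\<^esup>\<close>; so the remainder integrates to \<open>O(h\<^sup>2)\<close>.  The new integrand satisfies the same integrability condition as \<open>g\<close>,
  so the lemma can be iterated.  The exponent function is left general because both \<open>s t = t\<close>
  and \<open>s t = 1/t\<close> occur.
\<close>

lemma has_field_derivative_laplace_integral:
  fixes M :: "'a measure" and s :: "'a \<Rightarrow> real" and g :: "'a \<Rightarrow> complex" and z :: complex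
  assumes [measurable]: "s \<in> borel_measurable M" "g \<in> borel_measurable M"
    and s: "\<And>x. x \<in> space M \<Longrightarrow> s x \<ge> 0"
    and int: "\<And>\<sigma>. \<sigma> > 0 \<Longrightarrow> integrable M (\<lambda>x. exp (- (\<sigma> * s x)) * norm (g x))"
    and z: "Re z > 0"
  shows "((\<lambda>z. \<integral>x. exp (- (z * of_real (s x))) * g x \<partial>M) has_field_derivative
            (\<integral>x. exp (- (z * of_real (s x))) * (- of_real (s x) * g x) \<partial>M)) (at z)"
    and "\<And>\<sigma>. \<sigma> > 0 \<Longrightarrow> integrable M (\<lambda>x. exp (- (\<sigma> * s x)) * norm (- of_real (s x) * g x))"
    and "integrable M (\<lambda>x. exp (- (z * of_real (s x))) * g x)"
proof -
  have le1: "u * exp (- (\<sigma> * u)) \<le> 1 / \<sigma>" if "\<sigma> > 0" for u \<sigma> :: real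
  proof -
    have "\<sigma> * u \<le> exp (\<sigma> * u)" using exp_ge_add_one_self[of "\<sigma> * u"] by linarith
    thus ?thesis using that by (simp add: exp_minus field_simps)
  qed
  have int0: "integrable M (\<lambda>x. exp (- (w * of_real (s x))) * g x)" if "Re w > 0" for w
    by (rule Bochner_Integration.integrable_bound[OF int[OF that]]) (auto simp: norm_mult)
  have int1: "integrable M (\<lambda>x. exp (- (\<sigma> * s x)) * norm (- of_real (s x) * g x))" if \<sigma>: "\<sigma> > 0" for \<sigma>
  proof (rule Bochner_Integration.integrable_bound)
    show "integrable M (\<lambda>x. (1 / (\<sigma>/2)) * (exp (- (\<sigma>/2 * s x)) * norm (g x)))"
      by (intro integrable_mult_right int) (use \<sigma> in auto)
    show "AE x in M. norm (exp (- (\<sigma> * s x)) * norm (- of_real (s x) * g x))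
            \<le> norm ((1 / (\<sigma>/2)) * (exp (- (\<sigma>/2 * s x)) * norm (g x)))"
    proof (rule AE_I2)
      fix x assume "x \<in> space M"
      hence "norm (exp (- (\<sigma> * s x)) * norm (- of_real (s x) * g x)) =
             (s x * exp (- (\<sigma>/2 * s x))) * (exp (- (\<sigma>/2 * s x)) * norm (g x))"
        using s by (simp add: norm_mult mult_ac flip: exp_add)
      also have "\<dots> \<le> (1 / (\<sigma>/2)) * (exp (- (\<sigma>/2 * s x)) * norm (g x))"
        by (intro mult_right_mono le1) (use \<sigma> in auto)
      finally show "norm (exp (- (\<sigma> * s x)) * norm (- of_real (s x) * g x))
            \<le> norm ((1 / (\<sigma>/2)) * (exp (- (\<sigma>/2 * s x)) * norm (g x)))" using \<sigma> by simp
    qed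
  qed measurable
  show "\<And>\<sigma>. \<sigma> > 0 \<Longrightarrow> integrable M (\<lambda>x. exp (- (\<sigma> * s x)) * norm (- of_real (s x) * g x))"
    by (rule int1)
  show "integrable M (\<lambda>x. exp (- (z * of_real (s x))) * g x)" by (rule int0[OF z])
  have int0': "integrable M (\<lambda>x. exp (- (z * of_real (s x))) * (- of_real (s x) * g x))"
    by (rule Bochner_Integration.integrable_bound[OF int1[OF z]]) (auto simp: norm_mult)
  \<comment> \<open>of the four units of decay in \<open>e\<^bsup>-zs\<^esup>\<close>, one pays for \<open>e\<^bsup>|h|s\<^esup>\<close>, two for \<open>s\<^sup>2\<close>, one remains\<close>
  define \<sigma> where "\<sigma> = Re z / 4"
  have \<sigma>: "\<sigma> > 0" using z by (simp add: \<sigma>_def)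
  define B where "B = (\<integral>x. 1 / \<sigma> ^ 2 * (exp (- (\<sigma> * s x)) * norm (g x)) \<partial>M)"
  define L where "L = (\<lambda>z. \<integral>x. exp (- (z * of_real (s x))) * g x \<partial>M)"
  define D where "D = (\<integral>x. exp (- (z * of_real (s x))) * (- of_real (s x) * g x) \<partial>M)"
  have quad: "norm (L (z + h) - L z - h * D) \<le> (norm h)\<^sup>2 * B" if h: "norm h < \<sigma>" for h
  proof -
    have zh: "Re (z + h) > 0"
      using abs_Re_le_cmod[of h] h z by (auto simp: \<sigma>_def)
    define R where "R = (\<lambda>x. exp (- ((z + h) * of_real (s x))) * g x - exp (- (z * of_real (s x))) * g x
                      - h * (exp (- (z * of_real (s x))) * (- of_real (s x) * g x)))"
    have R_int: "integrable M R" unfolding R_def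
      by (intro Bochner_Integration.integrable_diff integrable_mult_right int0 int0' z zh)
    have "L (z + h) - L z - h * D = (\<integral>x. R x \<partial>M)"
      unfolding L_def D_def R_def
      by (subst Bochner_Integration.integral_diff;
          (intro Bochner_Integration.integrable_diff integrable_mult_right int0 int0' z zh)?)+
         (simp add: int0')
    also have "norm \<dots> \<le> (\<integral>x. norm h ^ 2 * (1 / \<sigma> ^ 2 * (exp (- (\<sigma> * s x)) * norm (g x))) \<partial>M)"
    proof (rule order.trans[OF Bochner_Integration.integral_norm_bound Bochner_Integration.integral_mono])
      show "integrable M (\<lambda>x. norm (R x))" using R_int by (rule integrable_norm)
      show "integrable M (\<lambda>x. norm h ^ 2 * (1 / \<sigma> ^ 2 * (exp (- (\<sigma> * s x)) * norm (g x))))"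
        by (intro integrable_mult_right int \<sigma>)
      fix x assume x: "x \<in> space M"
      define u where "u = s x"
      have u: "u \<ge> 0" using s x by (simp add: u_def)
      have R: "R x = exp (- (z * of_real u)) * g x * (exp (- (h * of_real u)) - (\<Sum>k\<le>1. (- (h * of_real u)) ^ k / fact k))"
        by (simp add: R_def u_def algebra_simps exp_add exp_diff divide_simps exp_minus)
      have "norm (exp (- (h * of_real u)) - (\<Sum>k\<le>1. (- (h * of_real u)) ^ k / fact k))
              \<le> exp \<bar>Re (- (h * of_real u))\<bar> * norm (- (h * of_real u)) ^ Suc 1 / fact 1"
        by (rule Taylor_exp)
      also have "\<dots> = exp (\<bar>Re h\<bar> * u) * (norm h)\<^sup>2 * u\<^sup>2"
        using u by (simp add: abs_mult norm_mult power_mult_distrib power2_eq_square)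
      also have "\<dots> \<le> exp (\<sigma> * u) * (norm h)\<^sup>2 * u\<^sup>2"
        using abs_Re_le_cmod[of h] h u by (intro mult_right_mono) (auto intro: mult_right_mono)
      finally have T: "norm (exp (- (h * of_real u)) - (\<Sum>k\<le>1. (- (h * of_real u)) ^ k / fact k))
          \<le> exp (\<sigma> * u) * (norm h)\<^sup>2 * u\<^sup>2" .
      have "norm (R x) \<le> exp (- (4 * \<sigma> * u)) * norm (g x) * (exp (\<sigma> * u) * (norm h)\<^sup>2 * u\<^sup>2)"
        unfolding R norm_mult by (intro mult_mono T) (auto simp: \<sigma>_def)
      also have "\<dots> = (norm h)\<^sup>2 * norm (g x) * exp (- (\<sigma> * u)) * (u * exp (- (\<sigma> * u)))\<^sup>2"
        by (simp add: power_mult_distrib power2_eq_square mult_ac flip: exp_add)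
      also have "\<dots> \<le> (norm h)\<^sup>2 * norm (g x) * exp (- (\<sigma> * u)) * (1 / \<sigma>)\<^sup>2"
        by (intro mult_left_mono power_mono le1 \<sigma>) (use u in auto)
      finally show "norm (R x) \<le> norm h ^ 2 * (1 / \<sigma> ^ 2 * (exp (- (\<sigma> * s x)) * norm (g x)))"
        by (simp add: u_def mult_ac power_divide)
    qed
    also have "\<dots> = (norm h)\<^sup>2 * B" by (simp add: B_def)
    finally show ?thesis .
  qed
  have "(L has_field_derivative D) (at z)"
    unfolding DERIV_def
  proof (rule LIM_zero_cancel, rule Lim_null_comparison)
    have "eventually (\<lambda>h. norm (h::complex) < \<sigma> \<and> h \<noteq> 0) (at 0)"
      using \<sigma> by (auto simp: eventually_at intro!: exI[of _ \<sigma>])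
    thus "eventually (\<lambda>h. norm ((L (z + h) - L z) / h - D) \<le> norm h * B) (at 0)"
    proof eventually_elim
      case (elim h)
      have "norm ((L (z + h) - L z) / h - D) = norm (L (z + h) - L z - h * D) / norm h"
        using elim by (simp add: divide_simps mult.commute flip: norm_divide)
      also have "\<dots> \<le> (norm h)\<^sup>2 * B / norm h"
        by (intro divide_right_mono quad) (use elim in auto)
      also have "\<dots> = norm h * B" using elim by (simp add: power2_eq_square)
      finally show ?case .
    qed
    show "((\<lambda>h::complex. norm h * B) \<longlongrightarrow> 0) (at 0)"
      by (auto intro!: tendsto_eq_intros)
  qed
  thus "((\<lambda>z. \<integral>x. exp (- (z * of_real (s x))) * g x \<partial>M) has_field_derivative
            (\<integral>x. exp (- (z * of_real (s x))) * (- of_real (s x) * g x) \<partial>M)) (at z)"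
    by (simp add: L_def D_def)
qed

section \<open>The Macdonald integral\<close>

text \<open>
  This is \<open>2 (y/p)\<^bsup>\<mu>/2\<^esup> K\<^sub>\<mu>(2 \<surd>(py))\<close>.  Keeping \<open>p\<close> and \<open>y\<close> apart makes it holomorphic in each of them
  on the right half-plane, with no square root to track.  It converges for all such \<open>p\<close> and \<open>y\<close>, whereas
  \<open>\<integral> t\<^bsup>-\<mu>-1\<^esup> e\<^bsup>-t-w/t\<^esup> dt\<close> with \<open>w = py\<close> diverges as soon as \<open>Re (py) < 0\<close>.
\<close>

definition macdonald_integral :: "real \<Rightarrow> complex \<Rightarrow> complex \<Rightarrow> complex" where
  "macdonald_integral \<mu> p y =
     (\<integral>t. of_real (t powr (- \<mu> - 1)) * exp (- (y * of_real t) - p / of_real t) \<partial>pos_lborel)"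

lemma macdonald_integral_integrable:
  assumes "Re p > 0" "Re y > 0"
  shows "integrable pos_lborel (\<lambda>t. of_real (t powr m) * exp (- (y * of_real t) - p / of_real t))"
  by (rule integrable_pos_lborel_bound[OF powr_mult_exp_integrable[of "Re p" "Re y" m]])
     (use assms in \<open>auto simp: norm_mult Re_divide_of_real\<close>)

lemma has_field_derivative_macdonald_integral:
  assumes "Re p > 0" "Re y > 0"
  shows "(macdonald_integral \<mu> p has_field_derivative - macdonald_integral (\<mu> - 1) p y) (at y)"
proof -
  define g where "g = (\<lambda>t::real. of_real (t powr (- \<mu> - 1)) * exp (- (p / of_real t)))"
  have "((\<lambda>z. \<integral>t. exp (- (z * of_real t)) * g t \<partial>pos_lborel) has_field_derivative
            (\<integral>t. exp (- (y * of_real t)) * (- of_real t * g t) \<partial>pos_lborel)) (at y)"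
  proof (rule has_field_derivative_laplace_integral)
    fix \<sigma> :: real assume "\<sigma> > 0"
    have "(\<lambda>t. exp (- (\<sigma> * t)) * norm (g t)) = (\<lambda>t. t powr (- \<mu> - 1) * exp (- (\<sigma> * t) - Re p / t))"
    proof
      fix t :: real
      have "exp (- (\<sigma> * t) - Re p / t) = exp (- (\<sigma> * t)) * exp (- (Re p / t))"
        by (simp flip: exp_add)
      thus "exp (- (\<sigma> * t)) * norm (g t) = t powr (- \<mu> - 1) * exp (- (\<sigma> * t) - Re p / t)"
        by (simp add: g_def norm_mult Re_divide_of_real)
    qed
    thus "integrable pos_lborel (\<lambda>t. exp (- (\<sigma> * t)) * norm (g t))"
      using powr_mult_exp_integrable[of "Re p" \<sigma> "- \<mu> - 1"] assms \<open>\<sigma> > 0\<close> by simp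
  qed (use assms in \<open>auto simp: g_def space_pos_lborel\<close>)
  also have "(\<lambda>z. \<integral>t. exp (- (z * of_real t)) * g t \<partial>pos_lborel) = macdonald_integral \<mu> p"
    by (auto simp: macdonald_integral_def g_def exp_diff exp_minus field_simps)
  also have "(\<integral>t. exp (- (y * of_real t)) * (- of_real t * g t) \<partial>pos_lborel) = 
             (\<integral>t. - (of_real (t powr (- (\<mu> - 1) - 1)) * exp (- (y * of_real t) - p / of_real t)) \<partial>pos_lborel)"
  proof (rule integral_pos_lborel_cong)
    fix t :: real assume t: "t > 0"
    have "t powr (- (\<mu> - 1) - 1) = t * t powr (- \<mu> - 1)"
      using t by (simp add: powr_diff powr_minus)
    thus "exp (- (y * of_real t)) * (- of_real t * g t) =
          - (of_real (t powr (- (\<mu> - 1) - 1)) * exp (- (y * of_real t) - p / of_real t))"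
      by (simp add: g_def exp_diff exp_minus field_simps)
  qed
  also have "\<dots> = - macdonald_integral (\<mu> - 1) p y"
    by (simp add: macdonald_integral_def)
  finally show ?thesis .
qed

lemma has_vector_derivative_powr_mult_exp:
  fixes t m :: real and p y :: complex
  assumes t: "t > 0"
  shows "((\<lambda>t. of_real (t powr m) * exp (- (y * of_real t) - p / of_real t)) has_vector_derivative
     (of_real m * (of_real (t powr (m - 1)) * exp (- (y * of_real t) - p / of_real t))
      - y * (of_real (t powr m) * exp (- (y * of_real t) - p / of_real t))
      + p * (of_real (t powr (m - 2)) * exp (- (y * of_real t) - p / of_real t)))) (at t)"
proof -
  have 1: "((\<lambda>t. of_real (t powr m) :: complex) has_vector_derivative of_real (m * t powr (m - 1))) (at t)"
    by (intro has_vector_derivative_of_real)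
       (use t in \<open>auto intro!: derivative_eq_intros simp: has_real_derivative_iff_has_vector_derivative[symmetric]\<close>)
  have 2: "((\<lambda>t. exp (- (y * of_real t) - p / of_real t)) has_vector_derivative
      exp (- (y * of_real t) - p / of_real t) * (- y + p / of_real t ^ 2)) (at t)"
    by (rule has_vector_derivative_real_field)
       (use t in \<open>auto intro!: derivative_eq_intros simp: power2_eq_square\<close>)
  have 3: "t powr (m - 2) = t powr m / t ^ 2"
    using t by (simp add: powr_diff)
  show ?thesis
    using has_vector_derivative_mult[OF 1 2]
    by (rule has_vector_derivative_eq_rhs) (simp add: 3 algebra_simps add_divide_distrib)
qed

text \<open>
  The derivative of \<open>t\<^bsup>-\<mu>\<^esup> e\<^bsup>-yt-p/t\<^esup>\<close> has integral \<open>0\<close>.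
\<close>

lemma macdonald_integral_recurrence:
  assumes "Re p > 0" "Re y > 0"
  shows "p * macdonald_integral (\<mu> + 1) p y = y * macdonald_integral (\<mu> - 1) p y + of_real \<mu> * macdonald_integral \<mu> p y"
proof -
  define e where "e = (\<lambda>m t. of_real (t powr m) * exp (- (y * of_real t) - p / of_real t) :: complex)"
  have ie: "integrable pos_lborel (e m)" for m
    unfolding e_def by (rule macdonald_integral_integrable[OF assms])
  have M: "macdonald_integral \<nu> p y = (\<integral>t. e (- \<nu> - 1) t \<partial>pos_lborel)" for \<nu>
    by (simp add: macdonald_integral_def e_def)
  have "(\<integral>t. of_real (- \<mu>) * e (- \<mu> - 1) t - y * e (- \<mu>) t + p * e (- \<mu> - 2) t \<partial>pos_lborel) = 0 - 0"
  proof (rule integral_pos_lborel_FTC[where F = "e (- \<mu>)"])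
    fix t :: real assume "t > 0"
    thus "(e (- \<mu>) has_vector_derivative of_real (- \<mu>) * e (- \<mu> - 1) t - y * e (- \<mu>) t + p * e (- \<mu> - 2) t) (at t)"
      unfolding e_def by (rule has_vector_derivative_powr_mult_exp)
    show "isCont (\<lambda>t. of_real (- \<mu>) * e (- \<mu> - 1) t - y * e (- \<mu>) t + p * e (- \<mu> - 2) t) t"
      unfolding e_def by (intro continuous_intros) (use \<open>t > 0\<close> in auto)
  next
    show "integrable pos_lborel (\<lambda>t. of_real (- \<mu>) * e (- \<mu> - 1) t - y * e (- \<mu>) t + p * e (- \<mu> - 2) t)"
      by (intro Bochner_Integration.integrable_add Bochner_Integration.integrable_diff integrable_mult_right ie)
  qed (unfold e_def, (rule powr_mult_exp_tendsto_0[OF assms])+)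
  also have "(\<integral>t. of_real (- \<mu>) * e (- \<mu> - 1) t - y * e (- \<mu>) t + p * e (- \<mu> - 2) t \<partial>pos_lborel) =
     of_real (- \<mu>) * macdonald_integral \<mu> p y - y * macdonald_integral (\<mu> - 1) p y + p * macdonald_integral (\<mu> + 1) p y"
  proof -
    have idx: "- (\<mu> + 1) - 1 = - \<mu> - 2" "- (\<mu> - 1) - 1 = - \<mu>" by simp_all
    show ?thesis
      by (simp add: M[of \<mu>] M[of "\<mu> + 1", unfolded idx] M[of "\<mu> - 1", unfolded idx] ie del: of_real_minus)
  qed
  finally show ?thesis by (simp add: algebra_simps)
qed

lemma integral_pos_lborel_inverse:
  fixes f :: "real \<Rightarrow> complex"
  assumes [measurable]: "f \<in> borel_measurable borel" and f: "integrable pos_lborel f"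
  shows "integrable pos_lborel (\<lambda>t. (1 / t\<^sup>2) *\<^sub>R f (1 / t))"
    and "(\<integral>t. (1 / t\<^sup>2) *\<^sub>R f (1 / t) \<partial>pos_lborel) = integral\<^sup>L pos_lborel f"
proof -
  have img: "(\<lambda>t. 1 / t) ` {0<..} = {0::real<..}"
  proof (intro set_eqI iffI)
    fix x :: real assume "x \<in> {0<..}"
    hence "x = 1 / (1 / x)" "1 / x \<in> {0<..}" by auto
    thus "x \<in> (\<lambda>t. 1 / t) ` {0<..}" by (rule image_eqI)
  qed auto
  have lb: "set_integrable lborel {0<..} h \<longleftrightarrow> h absolutely_integrable_on {0<..}"
    if [measurable]: "h \<in> borel_measurable borel" for h :: "real \<Rightarrow> complex"
    unfolding set_integrable_def by (subst integrable_completion) auto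
  have f': "set_integrable lborel {0<..} f" using f by (simp add: integrable_pos_lborel_iff)
  have eq: "\<bar>- (1 / t\<^sup>2)\<bar> = 1 / t\<^sup>2" for t :: real by simp
  have der: "((\<lambda>t. 1 / t) has_field_derivative - (1 / t\<^sup>2)) (at t within {0<..})" if "t \<in> {0<..}" for t :: real
    using that by (auto intro!: derivative_eq_intros simp: power2_eq_square)
  have inj: "inj_on (\<lambda>t::real. 1 / t) {0<..}" by (auto intro!: inj_onI)
  have *: "(\<lambda>t. (1 / t\<^sup>2) *\<^sub>R f (1 / t)) absolutely_integrable_on {0<..} \<and>
        integral {0<..} (\<lambda>t. (1 / t\<^sup>2) *\<^sub>R f (1 / t)) = integral {0<..} f"
    using has_absolute_integral_change_of_variables_real[of "{0<..}" "\<lambda>t. 1 / t" "\<lambda>t. - (1 / t\<^sup>2)" f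
       "integral {0<..} f", OF _ der inj, unfolded img eq] f' lb[of f]
    by simp
  hence s: "set_integrable lborel {0<..} (\<lambda>t. (1 / t\<^sup>2) *\<^sub>R f (1 / t))"
    by (subst lb) auto
  thus "integrable pos_lborel (\<lambda>t. (1 / t\<^sup>2) *\<^sub>R f (1 / t))" by (simp add: integrable_pos_lborel_iff)
  show "(\<integral>t. (1 / t\<^sup>2) *\<^sub>R f (1 / t) \<partial>pos_lborel) = integral\<^sup>L pos_lborel f"
    unfolding integral_pos_lborel set_borel_integral_eq_integral(2)[OF s] set_borel_integral_eq_integral(2)[OF f']
    using * by simp
qed

lemma Gamma_integral_pos_lborel:
  fixes \<alpha> \<rho> :: real
  assumes "\<alpha> > 0" "\<rho> > 0"
  shows "integrable pos_lborel (\<lambda>t. of_real (t powr (\<alpha> - 1) * exp (- (\<rho> * t))) :: complex)"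
    and "(\<integral>t. of_real (t powr (\<alpha> - 1) * exp (- t)) \<partial>pos_lborel) = (Gamma (of_real \<alpha>) :: complex)"
proof -
  have int: "integrable pos_lborel (\<lambda>t. of_real (t powr (\<alpha> - 1) * exp (- (\<rho> * t))) :: complex)" if "\<rho> > 0" for \<rho>
  proof -
    have "(\<lambda>t. complex_of_real t powr (of_real \<alpha> - 1) / of_real (exp (\<rho> * t))) absolutely_integrable_on {0<..}"
      by (rule absolutely_integrable_Gamma_integral) (use assms that in auto)
    also have "?this \<longleftrightarrow> (\<lambda>t. of_real (t powr (\<alpha> - 1) * exp (- (\<rho> * t))) :: complex) absolutely_integrable_on {0<..}"
      by (rule set_integrable_cong) (auto simp: powr_of_real[symmetric] exp_minus field_simps)
    finally have "set_integrable lborel {0<..} (\<lambda>t. of_real (t powr (\<alpha> - 1) * exp (- (\<rho> * t))) :: complex)"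
      unfolding set_integrable_def by (subst (asm) integrable_completion) auto
    thus ?thesis by (simp add: integrable_pos_lborel_iff)
  qed
  show "integrable pos_lborel (\<lambda>t. of_real (t powr (\<alpha> - 1) * exp (- (\<rho> * t))) :: complex)"
    by (rule int) fact
  have "((\<lambda>t. complex_of_real t powr (of_real \<alpha> - 1) / of_real (exp t)) has_integral Gamma (of_real \<alpha>)) {0<..}"
    by (rule Gamma_integral_complex') (use assms in auto)
  also have "?this \<longleftrightarrow> ((\<lambda>t. of_real (t powr (\<alpha> - 1) * exp (- t)) :: complex) has_integral Gamma (of_real \<alpha>)) {0<..}"
    by (rule has_integral_cong) (auto simp: powr_of_real[symmetric] exp_minus field_simps)
  finally show "(\<integral>t. of_real (t powr (\<alpha> - 1) * exp (- t)) \<partial>pos_lborel) = (Gamma (of_real \<alpha>) :: complex)"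
    using int[of 1] by (simp add: integral_pos_lborel integrable_pos_lborel_iff set_borel_integral_eq_integral(2) integral_unique)
qed

lemma inverse_Gamma_integral_integrable:
  fixes \<alpha> :: real and p :: complex
  assumes "\<alpha> > 0" "Re p > 0"
  shows "integrable pos_lborel (\<lambda>t. of_real (t powr (- \<alpha> - 1)) * exp (- (p / of_real t)))"
proof -
  have "integrable pos_lborel (\<lambda>t. norm ((1 / t\<^sup>2) *\<^sub>R (of_real ((1 / t) powr (\<alpha> - 1) * exp (- (Re p * (1 / t)))) :: complex)))"
    by (intro integrable_norm integral_pos_lborel_inverse Gamma_integral_pos_lborel assms) measurable
  thus ?thesis
  proof (rule integrable_pos_lborel_bound)
    fix t :: real assume t: "t > 0"
    have "t powr (- \<alpha> - 1) = (1 / t\<^sup>2) * (1 / t) powr (\<alpha> - 1)"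
      using t by (simp add: powr_diff powr_minus powr_divide field_simps power2_eq_square)
    thus "norm (of_real (t powr (- \<alpha> - 1)) * exp (- (p / of_real t)))
       \<le> norm ((1 / t\<^sup>2) *\<^sub>R (of_real ((1 / t) powr (\<alpha> - 1) * exp (- (Re p * (1 / t)))) :: complex))"
      using t by (simp add: norm_mult norm_divide norm_power Re_divide_of_real)
  qed measurable
qed

text \<open>
  This is the Macdonald integral at \<open>y = 0\<close>.  For \<open>p = 1\<close> the substitution \<open>t \<mapsto> 1/t\<close> gives Euler's integral.
  For complex \<open>p\<close> no such substitution is available; instead, integration by parts shows that the
  product of the integral with \<open>p\<^sup>\<alpha>\<close> has derivative \<open>0\<close> in the half-plane.
\<close>

lemma inverse_Gamma_integral:
  fixes \<alpha> :: real and p :: complex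
  assumes \<alpha>: "\<alpha> > 0" and p: "Re p > 0"
  shows "(\<integral>t. of_real (t powr (- \<alpha> - 1)) * exp (- (p / of_real t)) \<partial>pos_lborel) =
           Gamma (of_real \<alpha>) * p powr (- of_real \<alpha>)"
proof -
  define N where "N = (\<lambda>(\<alpha>::real) (p::complex). \<integral>t. of_real (t powr (- \<alpha> - 1)) * exp (- (p / of_real t)) \<partial>pos_lborel)"
  have N': "(N \<alpha> has_field_derivative - N (\<alpha> + 1) p) (at p)" if p: "Re p > 0" for p
  proof -
    define g where "g = (\<lambda>t::real. of_real (t powr (- \<alpha> - 1)) :: complex)"
    have "((\<lambda>z. \<integral>t. exp (- (z * of_real (1 / t))) * g t \<partial>pos_lborel) has_field_derivative
            (\<integral>t. exp (- (p * of_real (1 / t))) * (- of_real (1 / t) * g t) \<partial>pos_lborel)) (at p)"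
    proof (rule has_field_derivative_laplace_integral)
      fix \<sigma> :: real assume "\<sigma> > 0"
      have "integrable pos_lborel (\<lambda>t. norm (of_real (t powr (- \<alpha> - 1)) * exp (- (complex_of_real \<sigma> / of_real t))))"
        by (intro integrable_norm inverse_Gamma_integral_integrable) (use \<alpha> \<open>\<sigma> > 0\<close> in auto)
      thus "integrable pos_lborel (\<lambda>t. exp (- (\<sigma> * (1 / t))) * norm (g t))"
        by (simp add: g_def norm_mult mult.commute Re_divide_of_real)
    qed (use p in \<open>auto simp: g_def space_pos_lborel\<close>)
    also have "(\<lambda>z. \<integral>t. exp (- (z * of_real (1 / t))) * g t \<partial>pos_lborel) = N \<alpha>"
      by (auto simp: N_def g_def mult.commute)
    also have "(\<integral>t. exp (- (p * of_real (1 / t))) * (- of_real (1 / t) * g t) \<partial>pos_lborel) = 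
             (\<integral>t. - (of_real (t powr (- (\<alpha> + 1) - 1)) * exp (- (p / of_real t))) \<partial>pos_lborel)"
      by (rule integral_pos_lborel_cong) (simp add: g_def powr_diff powr_minus powr_add field_simps power2_eq_square)
    also have "\<dots> = - N (\<alpha> + 1) p" by (simp add: N_def)
    finally show ?thesis .
  qed
  have parts: "p * N (\<alpha> + 1) p = of_real \<alpha> * N \<alpha> p" if p: "Re p > 0" for p
  proof -
    define e where "e = (\<lambda>m t. of_real (t powr m) * exp (- (p / of_real t)) :: complex)"
    have ie: "integrable pos_lborel (e (- \<beta> - 1))" if "\<beta> > 0" for \<beta>
      unfolding e_def by (rule inverse_Gamma_integral_integrable[OF that p])
    have ie': "integrable pos_lborel (e (- \<alpha> - 1))" "integrable pos_lborel (e (- \<alpha> - 2))"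
      using ie[of \<alpha>] ie[of "\<alpha> + 1"] \<alpha> by (simp_all add: algebra_simps)
    have "(\<integral>t. of_real (- \<alpha>) * e (- \<alpha> - 1) t + p * e (- \<alpha> - 2) t \<partial>pos_lborel) = 0 - 0"
    proof (rule integral_pos_lborel_FTC[where F = "e (- \<alpha>)"])
      fix t :: real assume t: "t > 0"
      show "(e (- \<alpha>) has_vector_derivative of_real (- \<alpha>) * e (- \<alpha> - 1) t + p * e (- \<alpha> - 2) t) (at t)"
        using has_vector_derivative_powr_mult_exp[OF t, of "- \<alpha>" 0 p] by (simp add: e_def)
      show "isCont (\<lambda>t. of_real (- \<alpha>) * e (- \<alpha> - 1) t + p * e (- \<alpha> - 2) t) t"
        unfolding e_def by (intro continuous_intros) (use t in auto)
    next
      show "integrable pos_lborel (\<lambda>t. of_real (- \<alpha>) * e (- \<alpha> - 1) t + p * e (- \<alpha> - 2) t)"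
        by (intro Bochner_Integration.integrable_add integrable_mult_right ie')
      have "((\<lambda>t. of_real (t powr (- \<alpha>)) * exp (- (1 * of_real t) - p / of_real t) * exp (of_real t)) \<longlongrightarrow> 0 * exp (of_real 0)) (at_right 0)"
        by (intro tendsto_mult powr_mult_exp_tendsto_0 tendsto_intros) (use p in auto)
      thus "(e (- \<alpha>) \<longlongrightarrow> 0) (at_right 0)"
        by (simp add: e_def mult.assoc flip: exp_add)
      show "(e (- \<alpha>) \<longlongrightarrow> 0) at_top"
      proof (rule Lim_null_comparison)
        show "eventually (\<lambda>t. norm (e (- \<alpha>) t) \<le> t powr (- \<alpha>)) at_top"
          using eventually_gt_at_top[of 0]
          by eventually_elim (use p in \<open>auto simp: e_def norm_mult Re_divide_of_real mult_le_cancel_left1\<close>)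
        show "((\<lambda>t. t powr (- \<alpha>)) \<longlongrightarrow> 0) at_top"
          by (rule tendsto_neg_powr) (use \<alpha> in \<open>auto intro: filterlim_ident\<close>)
      qed
    qed
    also have "(\<integral>t. of_real (- \<alpha>) * e (- \<alpha> - 1) t + p * e (- \<alpha> - 2) t \<partial>pos_lborel) =
        of_real (- \<alpha>) * (\<integral>t. e (- \<alpha> - 1) t \<partial>pos_lborel) + p * (\<integral>t. e (- \<alpha> - 2) t \<partial>pos_lborel)"
      by (simp add: ie' del: of_real_minus)
    finally show ?thesis by (simp add: N_def e_def algebra_simps)
  qed
  have "\<exists>c. \<forall>p\<in>{p. Re p > 0}. p powr (of_real \<alpha>) * N \<alpha> p = c"
  proof (rule has_field_derivative_zero_constant)
    fix p :: complex assume "p \<in> {p. Re p > 0}"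
    hence p: "Re p > 0" "p \<noteq> 0" "p \<notin> \<real>\<^sub>\<le>\<^sub>0" by (auto simp: complex_nonpos_Reals_iff)
    have "((\<lambda>p. p powr of_real \<alpha> * N \<alpha> p) has_field_derivative
             (of_real \<alpha> * p powr (of_real \<alpha> - 1)) * N \<alpha> p + (- N (\<alpha> + 1) p) * p powr of_real \<alpha>) (at p)"
      by (intro DERIV_mult has_field_derivative_powr N' p)
    also have "(of_real \<alpha> * p powr (of_real \<alpha> - 1)) * N \<alpha> p + (- N (\<alpha> + 1) p) * p powr of_real \<alpha> =
      p powr of_real \<alpha> / p * (of_real \<alpha> * N \<alpha> p - p * N (\<alpha> + 1) p)"
      using p by (simp add: powr_diff field_simps)
    also have "\<dots> = 0" using parts[OF p(1)] by simp
    finally show "((\<lambda>p. p powr of_real \<alpha> * N \<alpha> p) has_field_derivative 0) (at p within {p. Re p > 0})"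
      by (rule has_field_derivative_at_within)
  qed (rule convex_halfspace_Re_gt)
  then obtain c where c: "\<And>p. Re p > 0 \<Longrightarrow> p powr (of_real \<alpha>) * N \<alpha> p = c" by blast
  have "N \<alpha> 1 = (\<integral>t. (1 / t\<^sup>2) *\<^sub>R (of_real ((1 / t) powr (\<alpha> - 1) * exp (- (1 / t))) :: complex) \<partial>pos_lborel)"
    unfolding N_def
  proof (rule integral_pos_lborel_cong)
    fix t :: real assume t: "t > 0"
    have 1: "t powr (- \<alpha> - 1) = (1 / t\<^sup>2) * (1 / t) powr (\<alpha> - 1)"
      using t by (simp add: powr_diff powr_minus powr_divide field_simps power2_eq_square)
    have 2: "exp (- (1 / of_real t)) = (of_real (exp (- (1 / t))) :: complex)"
      by (simp flip: exp_of_real)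
    show "of_real (t powr (- \<alpha> - 1)) * exp (- (1 / of_real t)) =
       (1 / t\<^sup>2) *\<^sub>R (of_real ((1 / t) powr (\<alpha> - 1) * exp (- (1 / t))) :: complex)"
      unfolding 1 2 by (simp add: scaleR_conv_of_real)
  qed
  also have "\<dots> = (\<integral>t. of_real (t powr (\<alpha> - 1) * exp (- t)) \<partial>pos_lborel)"
    by (rule integral_pos_lborel_inverse(2)) (use Gamma_integral_pos_lborel(1)[OF \<alpha>, of 1] in auto)
  also have "\<dots> = Gamma (of_real \<alpha>)" by (rule Gamma_integral_pos_lborel(2)[OF \<alpha> zero_less_one])
  finally have "c = Gamma (of_real \<alpha>)" using c[of 1] by simp
  moreover have "p powr of_real \<alpha> \<noteq> 0" using p by auto
  ultimately have "N \<alpha> p = Gamma (of_real \<alpha>) / p powr of_real \<alpha>"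
    using c[OF p] by (metis nonzero_mult_div_cancel_left)
  thus ?thesis by (simp add: N_def powr_minus divide_inverse)
qed

section \<open>The connection formula\<close>

text \<open>
  The modified Bessel equation in the variable \<open>y\<close> is written as the first-order system
  \<open>u' = y\<^bsup>\<alpha>-1\<^esup> v\<close>, \<open>v' = p y\<^bsup>-\<alpha>\<^esup> u\<close>.  It is trace-free, so the Wronskian of two solutions is constant,
  and this constant can be read off along any sequence tending to the singular point \<open>0\<close>.
\<close>

lemma wronskian_constant:
  fixes p :: complex and \<alpha> :: real
  assumes u1: "\<And>y. Re y > 0 \<Longrightarrow> (u1 has_field_derivative y powr (of_real \<alpha> - 1) * v1 y) (at y)"
    and v1: "\<And>y. Re y > 0 \<Longrightarrow> (v1 has_field_derivative p * y powr (- of_real \<alpha>) * u1 y) (at y)"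
    and u2: "\<And>y. Re y > 0 \<Longrightarrow> (u2 has_field_derivative y powr (of_real \<alpha> - 1) * v2 y) (at y)"
    and v2: "\<And>y. Re y > 0 \<Longrightarrow> (v2 has_field_derivative p * y powr (- of_real \<alpha>) * u2 y) (at y)"
    and lim: "(\<lambda>n. u1 (of_real (1 / real (Suc n)))) \<longlonglongrightarrow> U1" "(\<lambda>n. v1 (of_real (1 / real (Suc n)))) \<longlonglongrightarrow> V1"
      "(\<lambda>n. u2 (of_real (1 / real (Suc n)))) \<longlonglongrightarrow> U2" "(\<lambda>n. v2 (of_real (1 / real (Suc n)))) \<longlonglongrightarrow> V2"
    and y: "Re y > 0"
  shows "u1 y * v2 y - u2 y * v1 y = U1 * V2 - U2 * V1"
proof -
  define W where "W = (\<lambda>y. u1 y * v2 y - u2 y * v1 y)"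
  have "\<exists>c. \<forall>y\<in>{y. Re y > 0}. W y = c"
  proof (rule has_field_derivative_zero_constant)
    fix y :: complex assume "y \<in> {y. Re y > 0}"
    hence y: "Re y > 0" by simp
    have "(W has_field_derivative 0) (at y)"
      unfolding W_def
      by (rule DERIV_cong[OF DERIV_diff[OF DERIV_mult[OF u1 v2] DERIV_mult[OF u2 v1]]]) 
         (simp_all add: y algebra_simps)
    thus "(W has_field_derivative 0) (at y within {y. Re y > 0})"
      by (rule has_field_derivative_at_within)
  qed (rule convex_halfspace_Re_gt)
  then obtain c where c: "\<And>y. Re y > 0 \<Longrightarrow> W y = c" by blast
  have "(\<lambda>n. W (of_real (1 / real (Suc n)))) \<longlonglongrightarrow> U1 * V2 - U2 * V1"
    unfolding W_def by (intro tendsto_intros lim)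
  moreover have "(\<lambda>n. W (of_real (1 / real (Suc n)))) = (\<lambda>n. c)"
    by (intro ext c) simp
  ultimately have "c = U1 * V2 - U2 * V1" by (simp add: LIMSEQ_const_iff)
  thus ?thesis using c[OF y] by (simp add: W_def)
qed

lemma tendsto_inverse_Suc: "(\<lambda>n. 1 / real (Suc n)) \<longlonglongrightarrow> 0"
  using LIMSEQ_inverse_real_of_nat by (simp add: inverse_eq_divide)

lemma tendsto_inverse_Suc_powr:
  assumes "a > 0"
  shows "(\<lambda>n. of_real (1 / real (Suc n)) powr (of_real a) :: complex) \<longlonglongrightarrow> 0"
proof -
  have "(\<lambda>n. of_real ((1 / real (Suc n)) powr a) :: complex) \<longlonglongrightarrow> of_real 0"
    by (intro tendsto_of_real tendsto_zero_powrI[OF tendsto_inverse_Suc tendsto_const _ assms]) auto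
  thus ?thesis by (simp add: powr_of_real del: of_real_divide of_nat_Suc)
qed

lemma macdonald_integral_tendsto_0:
  assumes "\<alpha> > 0" "Re p > 0"
  shows "(\<lambda>n. macdonald_integral \<alpha> p (of_real (1 / real (Suc n)))) \<longlonglongrightarrow> Gamma (of_real \<alpha>) * p powr (- of_real \<alpha>)"
  unfolding inverse_Gamma_integral[OF assms, symmetric] macdonald_integral_def
proof (rule pos_lborel_dominated_convergence)
  show "integrable pos_lborel (\<lambda>t. norm (of_real (t powr (- \<alpha> - 1)) * exp (- (p / of_real t))))"
    by (intro integrable_norm inverse_Gamma_integral_integrable assms)
  fix t :: real assume t: "t > 0"
  have "(\<lambda>n. of_real (t powr (- \<alpha> - 1)) * exp (- (of_real (1 / real (Suc n)) * of_real t) - p / of_real t))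
          \<longlonglongrightarrow> of_real (t powr (- \<alpha> - 1)) * exp (- (of_real 0 * of_real t) - p / of_real t)"
    by (intro tendsto_intros tendsto_inverse_Suc) 
  thus "(\<lambda>n. of_real (t powr (- \<alpha> - 1)) * exp (- (of_real (1 / real (Suc n)) * of_real t) - p / of_real t))
          \<longlonglongrightarrow> of_real (t powr (- \<alpha> - 1)) * exp (- (p / of_real t))" by simp
  fix n
  show "norm (of_real (t powr (- \<alpha> - 1)) * exp (- (of_real (1 / real (Suc n)) * of_real t) - p / of_real t))
     \<le> norm (of_real (t powr (- \<alpha> - 1)) * exp (- (p / of_real t)))"
    using t by (simp add: norm_mult mult_left_mono)
qed measurable

text \<open>
  The integral itself blows up as \<open>y \<rightarrow> 0\<close>, since its integrand loses its decay at \<open>\<infinity>\<close>.  Substituting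
  \<open>t = s/y\<close> moves \<open>y\<close> from that end to the other, \<open>\<integral> s\<^bsup>-\<alpha>\<^esup> e\<^bsup>-s-py/s\<^esup> ds\<close>, where
  dominated convergence applies.
\<close>

lemma macdonald_integral_scaled_tendsto_0:
  assumes "\<alpha> < 1" "Re p > 0"
  shows "(\<lambda>n. of_real (1 / real (Suc n)) powr (1 - of_real \<alpha>) * macdonald_integral (\<alpha> - 1) p (of_real (1 / real (Suc n))))
            \<longlonglongrightarrow> Gamma (1 - of_real \<alpha>)"
proof -
  have eq: "of_real y powr (1 - of_real \<alpha>) * macdonald_integral (\<alpha> - 1) p (of_real y) =
     (\<integral>s. of_real (s powr (- \<alpha>)) * exp (- of_real s - p * of_real y / of_real s) \<partial>pos_lborel)"
    if y: "y > 0" for y :: real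
  proof -
    have "macdonald_integral (\<alpha> - 1) p (of_real y) = (1 / y) *\<^sub>R
       (\<integral>s. of_real ((1 / y * s) powr (- \<alpha>)) * exp (- (of_real y * of_real (1 / y * s)) - p / of_real (1 / y * s)) \<partial>pos_lborel)"
      unfolding macdonald_integral_def
      by (subst integral_pos_lborel_scale[of "1 / y"]) (use y in auto)
    also have "(\<integral>s. of_real ((1 / y * s) powr (- \<alpha>)) * exp (- (of_real y * of_real (1 / y * s)) - p / of_real (1 / y * s)) \<partial>pos_lborel) =
       (\<integral>s. of_real (y powr \<alpha>) * (of_real (s powr (- \<alpha>)) * exp (- of_real s - p * of_real y / of_real s)) \<partial>pos_lborel)"
    proof (rule integral_pos_lborel_cong)
      fix s :: real assume s: "s > 0"
      have 1: "(1 / y * s) powr (- \<alpha>) = y powr \<alpha> * s powr (- \<alpha>)"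
        using y s by (simp add: powr_divide powr_minus field_simps)
      have 2: "- (of_real y * of_real (1 / y * s)) - p / of_real (1 / y * s) = - of_real s - p * of_real y / of_real s"
        using y s by simp
      show "of_real ((1 / y * s) powr (- \<alpha>)) * exp (- (of_real y * of_real (1 / y * s)) - p / of_real (1 / y * s)) =
        of_real (y powr \<alpha>) * (of_real (s powr (- \<alpha>)) * exp (- of_real s - p * of_real y / of_real s))"
        unfolding 1 2 by simp
    qed
    also have "\<dots> = of_real (y powr \<alpha>) * (\<integral>s. of_real (s powr (- \<alpha>)) * exp (- of_real s - p * of_real y / of_real s) \<partial>pos_lborel)"
      by (rule Bochner_Integration.integral_mult_right_zero)
    finally have E: "macdonald_integral (\<alpha> - 1) p (of_real y) = (1 / y) *\<^sub>R (of_real (y powr \<alpha>) * (\<integral>s. of_real (s powr (- \<alpha>)) * exp (- of_real s - p * of_real y / of_real s) \<partial>pos_lborel))" .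
    have "of_real y powr (1 - of_real \<alpha>) = (of_real (y powr (1 - \<alpha>)) :: complex)"
      using y by (simp flip: powr_of_real)
    moreover have "y powr (1 - \<alpha>) * y powr \<alpha> = y"
      using y by (simp flip: powr_add)
    hence "of_real (y powr (1 - \<alpha>)) * of_real (y powr \<alpha>) = (of_real y :: complex)"
      by (simp flip: of_real_mult)
    ultimately show ?thesis unfolding E using y
      by (simp add: scaleR_conv_of_real field_simps)
  qed
  have "(\<lambda>n. \<integral>s. of_real (s powr (- \<alpha>)) * exp (- of_real s - p * of_real (1 / real (Suc n)) / of_real s) \<partial>pos_lborel) 
           \<longlonglongrightarrow> (\<integral>s. of_real (s powr ((1 - \<alpha>) - 1) * exp (- s)) \<partial>pos_lborel)"
  proof (rule pos_lborel_dominated_convergence)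
    have "integrable pos_lborel (\<lambda>t. norm (of_real (t powr ((1 - \<alpha>) - 1) * exp (- (1 * t))) :: complex))"
      by (intro integrable_norm Gamma_integral_pos_lborel) (use assms in auto)
    thus "integrable pos_lborel (\<lambda>s. s powr (- \<alpha>) * exp (- s))" by (simp add: norm_mult)
    fix s :: real assume s: "s > 0"
    have "(\<lambda>n. of_real (s powr (- \<alpha>)) * exp (- of_real s - p * of_real (1 / real (Suc n)) / of_real s))
      \<longlonglongrightarrow> of_real (s powr (- \<alpha>)) * exp (- of_real s - p * of_real 0 / of_real s)"
      by (intro tendsto_intros tendsto_inverse_Suc) (use s in auto)
    also have "of_real (s powr (- \<alpha>)) * exp (- of_real s - p * of_real 0 / of_real s) = (of_real (s powr ((1 - \<alpha>) - 1) * exp (- s)) :: complex)"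
      by (simp flip: exp_of_real)
    finally show "(\<lambda>n. of_real (s powr (- \<alpha>)) * exp (- of_real s - p * of_real (1 / real (Suc n)) / of_real s))
      \<longlonglongrightarrow> of_real (s powr ((1 - \<alpha>) - 1) * exp (- s))" .
    fix n
    have "Re (p * of_real (1 / real (Suc n)) / of_real s) \<ge> 0"
      using s assms by (simp add: Re_divide_of_real del: of_nat_Suc)
    thus "norm (of_real (s powr (- \<alpha>)) * exp (- of_real s - p * of_real (1 / real (Suc n)) / of_real s)) \<le> s powr (- \<alpha>) * exp (- s)"
      using s by (simp add: norm_mult mult_left_mono del: of_nat_Suc)
  qed measurable
  also have "(\<integral>s. of_real (s powr ((1 - \<alpha>) - 1) * exp (- s)) \<partial>pos_lborel) = Gamma (of_real (1 - \<alpha>) :: complex)"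
    by (rule Gamma_integral_pos_lborel(2)[OF _ zero_less_one]) (use assms in auto)
  finally show ?thesis by (subst eq) auto
qed

text \<open>
  In terms of \<open>I\<close> this is a multiple of \<open>I\<^bsub>-\<mu>\<^esub> - I\<^sub>\<mu>\<close>, the numerator in the definition of \<open>K\<^sub>\<mu>\<close>.
\<close>

definition macdonald_numerator :: "real \<Rightarrow> complex \<Rightarrow> complex \<Rightarrow> complex" where
  "macdonald_numerator \<mu> p y = p powr (- of_real \<mu>) * bessel_clifford (- \<mu>) (p * y)
     - y powr of_real \<mu> * bessel_clifford \<mu> (p * y)"

text \<open>
  The integral and the two power series give three solutions \<open>(u\<^sub>1, v\<^sub>1)\<close>, \<open>(u\<^sub>2, v\<^sub>2)\<close>, \<open>(u\<^sub>3, v\<^sub>3)\<close> of the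
  same linear system of rank two.  Any three vectors of the plane satisfy
  \<open>W\<^sub>2\<^sub>3 u\<^sub>1 + W\<^sub>3\<^sub>1 u\<^sub>2 + W\<^sub>1\<^sub>2 u\<^sub>3 = 0\<close> and the same relation for \<open>v\<close>, where \<open>W\<^sub>i\<^sub>j\<close> are the Wronskians; these
  are constant, and their values at \<open>y = 0\<close> are \<open>W\<^sub>2\<^sub>3 = sin(\<alpha>\<pi>)/\<pi>\<close> (reflection formula), \<open>W\<^sub>3\<^sub>1 = - p\<^bsup>-\<alpha>\<^esup>\<close> and \<open>W\<^sub>1\<^sub>2 = 1\<close>.
  The relation for \<open>u\<close> is the formula at order \<open>\<alpha>\<close>, the one for \<open>v\<close> the formula at order \<open>\<alpha> - 1\<close>.
\<close>

lemma macdonald_integral_conv_bessel_clifford_unit: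
  assumes \<alpha>: "0 < \<alpha>" "\<alpha> < 1" and p: "Re p > 0" and y: "Re y > 0"
  shows "of_real (sin (\<alpha> * pi) / pi) * macdonald_integral \<alpha> p y = macdonald_numerator \<alpha> p y"
    and "of_real (sin (\<alpha> * pi) / pi) * macdonald_integral (\<alpha> - 1) p y = - macdonald_numerator (\<alpha> - 1) p y"
proof -
  let ?a = "of_real \<alpha> :: complex"
  define u1 v1 where "u1 = macdonald_integral \<alpha> p" and "v1 = (\<lambda>y. - (y powr (1 - ?a) * macdonald_integral (\<alpha> - 1) p y))"
  define u2 v2 where "u2 = (\<lambda>y. bessel_clifford (- \<alpha>) (p * y))" and "v2 = (\<lambda>y. y powr (1 - ?a) * (p * bessel_clifford (1 - \<alpha>) (p * y)))"
  define u3 v3 where "u3 = (\<lambda>y. y powr ?a * bessel_clifford \<alpha> (p * y))" and "v3 = (\<lambda>y. bessel_clifford (\<alpha> - 1) (p * y))"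
  have pw: "y powr (?a - 1) * y powr (1 - ?a) = 1" "y powr (- ?a) * y powr ?a = 1" "y \<notin> \<real>\<^sub>\<le>\<^sub>0" "y \<noteq> 0"
      "y powr (- ?a) * y = y powr (1 - ?a)" "y powr (?a - 1) * y = y powr ?a" if "Re y > 0" for y
    using that by (auto simp: complex_nonpos_Reals_iff powr_diff powr_minus field_simps)
  have u1': "(u1 has_field_derivative y powr (?a - 1) * v1 y) (at y)" if y: "Re y > 0" for y
    using has_field_derivative_macdonald_integral[OF p y, of \<alpha>] pw(1)[OF y]
    by (simp add: u1_def v1_def mult.assoc[symmetric])
  have v1': "(v1 has_field_derivative p * y powr (- ?a) * u1 y) (at y)" if y: "Re y > 0" for y
  proof -
    have "(v1 has_field_derivative - ((1 - ?a) * y powr (1 - ?a - 1) * macdonald_integral (\<alpha> - 1) p y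
             + - macdonald_integral (\<alpha> - 1 - 1) p y * y powr (1 - ?a))) (at y)"
      unfolding v1_def
      by (intro DERIV_minus DERIV_mult has_field_derivative_powr has_field_derivative_macdonald_integral p y pw)
    also have "- ((1 - ?a) * y powr (1 - ?a - 1) * macdonald_integral (\<alpha> - 1) p y
             + - macdonald_integral (\<alpha> - 1 - 1) p y * y powr (1 - ?a)) =
        y powr (- ?a) * (y * macdonald_integral (\<alpha> - 1 - 1) p y + of_real (\<alpha> - 1) * macdonald_integral (\<alpha> - 1) p y)"
      using pw(5)[OF y, symmetric] by (simp add: algebra_simps)
    also have "\<dots> = p * y powr (- ?a) * u1 y"
      using macdonald_integral_recurrence[OF p y, of "\<alpha> - 1"] by (simp add: u1_def)
    finally show ?thesis .
  qed
  have u2': "(u2 has_field_derivative y powr (?a - 1) * v2 y) (at y)" if y: "Re y > 0" for y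
  proof -
    have "(u2 has_field_derivative (y powr (?a - 1) * y powr (1 - ?a)) * (p * bessel_clifford (1 - \<alpha>) (p * y))) (at y)"
      unfolding u2_def pw(1)[OF y] by (auto intro!: derivative_eq_intros)
    thus ?thesis by (simp add: v2_def mult_ac)
  qed
  have v2': "(v2 has_field_derivative p * y powr (- ?a) * u2 y) (at y)" if y: "Re y > 0" for y
  proof -
    have "(v2 has_field_derivative (1 - ?a) * y powr (1 - ?a - 1) * (p * bessel_clifford (1 - \<alpha>) (p * y))
             + (p * (bessel_clifford (1 - \<alpha> + 1) (p * y) * p)) * y powr (1 - ?a)) (at y)"
      (is "(_ has_field_derivative ?D) _")
      unfolding v2_def
      by (intro DERIV_mult has_field_derivative_powr pw[OF y]) (auto intro!: derivative_eq_intros)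
    also have "?D = p * y powr (- ?a) * ((p * y) * bessel_clifford (1 - \<alpha> + 1) (p * y) + of_real (1 - \<alpha>) * bessel_clifford (1 - \<alpha>) (p * y))"
      using pw(5)[OF y, symmetric] by (simp add: algebra_simps)
    also have "\<dots> = p * y powr (- ?a) * u2 y"
      unfolding bessel_clifford_recurrence by (simp add: u2_def)
    finally show ?thesis .
  qed
  have u3': "(u3 has_field_derivative y powr (?a - 1) * v3 y) (at y)" if y: "Re y > 0" for y
  proof -
    have "(u3 has_field_derivative ?a * y powr (?a - 1) * bessel_clifford \<alpha> (p * y)
             + (bessel_clifford (\<alpha> + 1) (p * y) * p) * y powr ?a) (at y)"
      (is "(_ has_field_derivative ?D) _")
      unfolding u3_def
      by (intro DERIV_mult has_field_derivative_powr pw[OF y]) (auto intro!: derivative_eq_intros)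
    also have "?D = y powr (?a - 1) * ((p * y) * bessel_clifford (\<alpha> + 1) (p * y) + ?a * bessel_clifford \<alpha> (p * y))"
      using pw(6)[OF y, symmetric] by (simp add: algebra_simps)
    also have "\<dots> = y powr (?a - 1) * v3 y"
      unfolding bessel_clifford_recurrence by (simp add: v3_def)
    finally show ?thesis .
  qed
  have v3': "(v3 has_field_derivative p * y powr (- ?a) * u3 y) (at y)" if y: "Re y > 0" for y
  proof -
    have "(v3 has_field_derivative p * (y powr (- ?a) * y powr ?a) * bessel_clifford \<alpha> (p * y)) (at y)"
      unfolding v3_def pw(2)[OF y] by (auto intro!: derivative_eq_intros)
    thus ?thesis by (simp add: u3_def mult_ac)
  qed
  have y0: "(\<lambda>n. complex_of_real (1 / real (Suc n))) \<longlonglongrightarrow> of_real 0"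
    by (intro tendsto_of_real tendsto_inverse_Suc)
  have E0: "(\<lambda>n. bessel_clifford \<mu> (p * of_real (1 / real (Suc n)))) \<longlonglongrightarrow> rGamma (of_real \<mu> + 1)" for \<mu>
    using isCont_tendsto_compose[OF isCont_bessel_clifford tendsto_mult[OF tendsto_const[of p] y0], of \<mu>]
    by (simp add: bessel_clifford_0)
  have l1: "(\<lambda>n. u1 (of_real (1 / real (Suc n)))) \<longlonglongrightarrow> Gamma ?a * p powr (- ?a)"
    unfolding u1_def by (rule macdonald_integral_tendsto_0) (use \<alpha> p in auto)
  have m1: "(\<lambda>n. v1 (of_real (1 / real (Suc n)))) \<longlonglongrightarrow> - Gamma (1 - ?a)"
    unfolding v1_def by (intro tendsto_minus macdonald_integral_scaled_tendsto_0) (use \<alpha> p in auto)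
  have l2: "(\<lambda>n. u2 (of_real (1 / real (Suc n)))) \<longlonglongrightarrow> rGamma (1 - ?a)"
    using E0[of "- \<alpha>"] by (simp add: u2_def)
  have "(\<lambda>n. v2 (of_real (1 / real (Suc n)))) \<longlonglongrightarrow> 0 * (p * rGamma (of_real (1 - \<alpha>) + 1))"
    unfolding v2_def using tendsto_inverse_Suc_powr[of "1 - \<alpha>"] \<alpha> by (intro tendsto_mult tendsto_const E0) auto
  hence m2: "(\<lambda>n. v2 (of_real (1 / real (Suc n)))) \<longlonglongrightarrow> 0" by simp
  have "(\<lambda>n. u3 (of_real (1 / real (Suc n)))) \<longlonglongrightarrow> 0 * rGamma (?a + 1)"
    unfolding u3_def using \<alpha> by (intro tendsto_mult tendsto_inverse_Suc_powr E0) auto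
  hence l3: "(\<lambda>n. u3 (of_real (1 / real (Suc n)))) \<longlonglongrightarrow> 0" by simp
  have m3: "(\<lambda>n. v3 (of_real (1 / real (Suc n)))) \<longlonglongrightarrow> rGamma ?a"
    using E0[of "\<alpha> - 1"] by (simp add: v3_def)
  have nz: "Gamma ?a * rGamma ?a = 1" "rGamma (1 - ?a) * Gamma (1 - ?a) = 1"
  proof -
    have "?a \<notin> \<int>\<^sub>\<le>\<^sub>0" "1 - ?a \<notin> \<int>\<^sub>\<le>\<^sub>0"
      using \<alpha> by (auto elim!: nonpos_Ints_cases simp: complex_eq_iff)
    thus "Gamma ?a * rGamma ?a = 1" "rGamma (1 - ?a) * Gamma (1 - ?a) = 1"
      by (simp_all add: rGamma_inverse_Gamma Gamma_eq_zero_iff)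
  qed
  have W12: "u1 y * v2 y - u2 y * v1 y = 1"
    using wronskian_constant[OF u1' v1' u2' v2' l1 m1 l2 m2 y] nz by simp
  have W23: "u2 y * v3 y - u3 y * v2 y = of_real (sin (\<alpha> * pi) / pi)"
  proof -
    have "rGamma ?a * rGamma (1 - ?a) = of_real (sin (\<alpha> * pi) / pi)"
      using rGamma_reflection_complex[of ?a] by (simp add: sin_of_real[symmetric] mult.commute)
    thus ?thesis using wronskian_constant[OF u2' v2' u3' v3' l2 m2 l3 m3 y] by (simp add: mult.commute)
  qed
  have W31: "u3 y * v1 y - u1 y * v3 y = - (p powr (- ?a))"
    using wronskian_constant[OF u3' v3' u1' v1' l3 m3 l1 m1 y] nz(1) by simp
  \<comment> \<open>the linear dependence of three vectors in the plane\<close>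
  have u: "(u2 y * v3 y - u3 y * v2 y) * u1 y = - (u3 y * v1 y - u1 y * v3 y) * u2 y - (u1 y * v2 y - u2 y * v1 y) * u3 y"
    and v: "(u2 y * v3 y - u3 y * v2 y) * v1 y = - (u3 y * v1 y - u1 y * v3 y) * v2 y - (u1 y * v2 y - u2 y * v1 y) * v3 y"
    by algebra+
  show "of_real (sin (\<alpha> * pi) / pi) * macdonald_integral \<alpha> p y = macdonald_numerator \<alpha> p y"
    using u unfolding W12 W23 W31 by (simp add: u1_def u2_def u3_def macdonald_numerator_def)
  have "of_real (sin (\<alpha> * pi) / pi) * macdonald_integral (\<alpha> - 1) p y = 
      - (y powr (?a - 1) * (of_real (sin (\<alpha> * pi) / pi) * v1 y))"
    using pw(1)[OF y] by (simp add: v1_def mult_ac)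
  also have "\<dots> = - (y powr (?a - 1) * (p powr (- ?a) * v2 y - v3 y))"
    using v unfolding W12 W23 W31 by simp
  also have "\<dots> = - ((y powr (?a - 1) * y powr (1 - ?a)) * (p powr (- ?a) * p) * bessel_clifford (1 - \<alpha>) (p * y)
       - y powr (?a - 1) * bessel_clifford (\<alpha> - 1) (p * y))"
    by (simp add: v2_def v3_def algebra_simps)
  also have "\<dots> = - macdonald_numerator (\<alpha> - 1) p y"
    unfolding pw(1)[OF y] pw(5)[OF p] by (simp add: macdonald_numerator_def)
  finally show "of_real (sin (\<alpha> * pi) / pi) * macdonald_integral (\<alpha> - 1) p y = - macdonald_numerator (\<alpha> - 1) p y" .
qed

lemma macdonald_numerator_recurrence:
  assumes "Re p > 0" "Re y > 0"
  shows "p * macdonald_numerator (\<mu> + 1) p y = y * macdonald_numerator (\<mu> - 1) p y - of_real \<mu> * macdonald_numerator \<mu> p y"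
proof -
  have nz: "p \<noteq> 0" "y \<noteq> 0" using assms by auto
  have P: "p powr (- of_real (\<mu> + 1)) = p powr (- of_real \<mu>) / p" "p powr (- of_real (\<mu> - 1)) = p powr (- of_real \<mu>) * p"
     "y powr (of_real (\<mu> + 1)) = y powr (of_real \<mu>) * y" "y powr (of_real (\<mu> - 1)) = y powr (of_real \<mu>) / y"
    using nz by (simp_all add: powr_diff powr_add powr_minus field_simps)
  have B: "bessel_clifford (- (\<mu> + 1)) (p * y) = p * y * bessel_clifford (- (\<mu> - 1)) (p * y) - of_real \<mu> * bessel_clifford (- \<mu>) (p * y)"
    "bessel_clifford (\<mu> - 1) (p * y) = p * y * bessel_clifford (\<mu> + 1) (p * y) + of_real \<mu> * bessel_clifford \<mu> (p * y)"
    using bessel_clifford_recurrence[of "p * y" "- \<mu>"] bessel_clifford_recurrence[of "p * y" \<mu>] by simp_all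
  show ?thesis
    unfolding macdonald_numerator_def P B using nz by (simp add: field_simps)
qed

text \<open>
  The two sides satisfy the same three-term recurrence up to a sign, which is that of
  \<open>sin(\<mu>\<pi>)\<close> under \<open>\<mu> \<mapsto> \<mu> + 1\<close>.  The range \<open>-1 < \<mu> < 2\<close> contains punctured neighbourhoods of \<open>0\<close> and \<open>1\<close>, the
  two integer orders at which \<open>K\<close> is wanted.
\<close>

lemma macdonald_integral_conv_bessel_clifford:
  assumes \<mu>: "- 1 < \<mu>" "\<mu> < 2" "\<mu> \<notin> \<int>" and p: "Re p > 0" and y: "Re y > 0"
  shows "of_real (sin (\<mu> * pi) / pi) * macdonald_integral \<mu> p y = macdonald_numerator \<mu> p y"
proof -
  have ne: "\<mu> \<noteq> 0" "\<mu> \<noteq> 1" using \<mu> by auto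
  consider "\<mu> < 0" | "0 < \<mu>" "\<mu> < 1" | "\<mu> > 1" using ne by linarith
  thus ?thesis
  proof cases
    case 1
    have "sin ((\<mu> + 1) * pi) = - sin (\<mu> * pi)" by (simp add: distrib_right)
    thus ?thesis using macdonald_integral_conv_bessel_clifford_unit(2)[of "\<mu> + 1" p y] 1 \<mu> p y by simp
  next
    case 2
    thus ?thesis using macdonald_integral_conv_bessel_clifford_unit(1)[of \<mu> p y] p y by simp
  next
    case 3
    define \<alpha> where "\<alpha> = \<mu> - 1"
    have \<alpha>: "0 < \<alpha>" "\<alpha> < 1" "\<mu> = \<alpha> + 1" using 3 \<mu> by (auto simp: \<alpha>_def)
    note aux = macdonald_integral_conv_bessel_clifford_unit[OF \<alpha>(1,2) p y]
    have s: "of_real (sin (\<mu> * pi) / pi) = (- of_real (sin (\<alpha> * pi) / pi) :: complex)"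
      by (simp add: distrib_right \<alpha>(3))
    have "p * (of_real (sin (\<mu> * pi) / pi) * macdonald_integral \<mu> p y) =
       - (of_real (sin (\<alpha> * pi) / pi) * (p * macdonald_integral (\<alpha> + 1) p y))"
      unfolding s by (simp add: \<alpha>(3))
    also have "\<dots> = - (y * (of_real (sin (\<alpha> * pi) / pi) * macdonald_integral (\<alpha> - 1) p y) 
                     + of_real \<alpha> * (of_real (sin (\<alpha> * pi) / pi) * macdonald_integral \<alpha> p y))"
      unfolding macdonald_integral_recurrence[OF p y, of \<alpha>] by (simp add: algebra_simps)
    also have "\<dots> = p * macdonald_numerator (\<alpha> + 1) p y"
      unfolding aux macdonald_numerator_recurrence[OF p y] by simp
    finally have "p * (of_real (sin (\<mu> * pi) / pi) * macdonald_integral \<mu> p y) = p * macdonald_numerator (\<alpha> + 1) p y" .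
    moreover have "p \<noteq> 0" using p by auto
    ultimately show ?thesis unfolding \<alpha>(3) by (metis mult_cancel_left)
  qed
qed

section \<open>Values of K at orders 0 and 1\<close>

text \<open>
  The definition of \<open>K\<close> at an integer order is a limit over non-integer orders; continuity
  in the order identifies this limit.
\<close>

lemma isCont_macdonald_integral_order:
  assumes p: "Re p > 0" and y: "Re y > 0"
  shows "isCont (\<lambda>\<mu>. macdonald_integral \<mu> p y) \<nu>"
  unfolding continuous_at_sequentially
proof (intro allI impI)
  fix X assume X: "X \<longlonglongrightarrow> \<nu>"
  have "Bseq (\<lambda>n. X n - \<nu>)"
    by (intro convergent_imp_Bseq convergentI[of _ "\<nu> - \<nu>"] tendsto_intros X)
  then obtain B where B: "\<And>n. \<bar>X n - \<nu>\<bar> \<le> B" by (auto simp: Bseq_def)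
  define e where "e = (\<lambda>t::real. exp (- (y * of_real t) - p / of_real t))"
  have "(\<lambda>n. \<integral>t. of_real (t powr (- X n - 1)) * e t \<partial>pos_lborel) \<longlonglongrightarrow> (\<integral>t. of_real (t powr (- \<nu> - 1)) * e t \<partial>pos_lborel)"
  proof (rule pos_lborel_dominated_convergence)
    show "integrable pos_lborel (\<lambda>t. norm (of_real (t powr (- \<nu> - 1 + B)) * e t) + norm (of_real (t powr (- \<nu> - 1 - B)) * e t))"
      unfolding e_def by (intro Bochner_Integration.integrable_add integrable_norm macdonald_integral_integrable p y)
    fix t :: real assume t: "t > 0"
    show "(\<lambda>n. of_real (t powr (- X n - 1)) * e t) \<longlonglongrightarrow> of_real (t powr (- \<nu> - 1)) * e t"
      by (intro tendsto_intros X) (use t in auto)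
    fix n
    have "t powr (- X n - 1) \<le> t powr (- \<nu> - 1 + B) + t powr (- \<nu> - 1 - B)"
    proof (cases "t \<ge> 1")
      case True
      have "t powr (- X n - 1) \<le> t powr (- \<nu> - 1 + B)"
        by (rule powr_mono) (use B[of n] True in auto)
      thus ?thesis using powr_ge_zero[of t "- \<nu> - 1 - B"] by linarith
    next
      case False
      have "t powr (- X n - 1) \<le> t powr (- \<nu> - 1 - B)"
        by (rule powr_mono') (use B[of n] False t in auto)
      thus ?thesis using powr_ge_zero[of t "- \<nu> - 1 + B"] by linarith
    qed
    hence "t powr (- X n - 1) * norm (e t) \<le> (t powr (- \<nu> - 1 + B) + t powr (- \<nu> - 1 - B)) * norm (e t)"
      by (rule mult_right_mono) auto
    thus "norm (of_real (t powr (- X n - 1)) * e t) \<le> norm (of_real (t powr (- \<nu> - 1 + B)) * e t) + norm (of_real (t powr (- \<nu> - 1 - B)) * e t)"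
      by (simp add: norm_mult distrib_right)
  qed (unfold e_def, measurable)
  thus "((\<lambda>\<mu>. macdonald_integral \<mu> p y) \<circ> X) \<longlonglongrightarrow> macdonald_integral \<nu> p y"
    by (simp add: macdonald_integral_def e_def o_def)
qed

text \<open>
  The principal logarithms of \<open>p\<close> and \<open>y\<close> have imaginary parts below \<open>\<pi>/2\<close> in modulus, so they can
  be averaged without leaving the principal branch.
\<close>

lemma csqrt_mult_csqrt_Ln:
  assumes p: "Re p > 0" and y: "Re y > 0"
  defines "b \<equiv> csqrt (2 * p) * csqrt (2 * y)"
  shows "b / 2 = exp ((Ln p + Ln y) / 2)" "Ln (b / 2) = (Ln p + Ln y) / 2"
proof -
  have nz: "p \<noteq> 0" "y \<noteq> 0" using p y by auto
  have L: "Ln (2 * z) = of_real (ln 2) + Ln z" if "z \<noteq> 0" for z :: complex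
    using Ln_times_of_real[of 2 z] Ln_of_real[of 2] that by simp
  have "b = exp (of_real (ln 2) + (Ln p + Ln y) / 2)"
    unfolding b_def using nz
    by (simp add: csqrt_exp_Ln L add_divide_distrib flip: exp_add)
  also have "\<dots> = 2 * exp ((Ln p + Ln y) / 2)"
    unfolding exp_add exp_of_real by simp
  finally show b: "b / 2 = exp ((Ln p + Ln y) / 2)" by simp
  have "\<bar>Im (Ln p)\<bar> < pi / 2" "\<bar>Im (Ln y)\<bar> < pi / 2"
    using Re_Ln_pos_lt[OF nz(1)] Re_Ln_pos_lt[OF nz(2)] p y by simp_all
  thus "Ln (b / 2) = (Ln p + Ln y) / 2"
    unfolding b by (intro Ln_exp) auto
qed

lemma Bessel_I_quotient_eq_macdonald_integral:
  assumes \<mu>: "- 1 < \<mu>" "\<mu> < 2" "\<mu> \<notin> \<int>" and p: "Re p > 0" and y: "Re y > 0"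
  defines "b \<equiv> csqrt (2 * p) * csqrt (2 * y)"
  shows "of_real pi / 2 * (Bessel_I (- \<mu>) b - Bessel_I \<mu> b) / of_real (sin (\<mu> * pi)) =
         exp (of_real \<mu> * ((Ln p - Ln y) / 2)) * macdonald_integral \<mu> p y / 2"
proof -
  have nz: "p \<noteq> 0" "y \<noteq> 0" "\<mu> \<noteq> 0" "b \<noteq> 0" using p y \<mu> by (auto simp: b_def)
  note b = csqrt_mult_csqrt_Ln[OF p y, folded b_def]
  have sq: "(b / 2)\<^sup>2 = p * y"
    by (simp add: b_def power_divide power_mult_distrib)
  have I: "Bessel_I \<nu> b = exp (of_real \<nu> * ((Ln p + Ln y) / 2)) * bessel_clifford \<nu> (p * y)" if "\<nu> \<noteq> 0" for \<nu>
    using that nz unfolding Bessel_I_conv_bessel_clifford sq by (simp add: powr_def b(2))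
  define X where "X = exp (of_real \<mu> * ((Ln p - Ln y) / 2))"
  have X: "X * p powr (- of_real \<mu>) = exp (- of_real \<mu> * ((Ln p + Ln y) / 2))"
     "X * y powr (of_real \<mu>) = exp (of_real \<mu> * ((Ln p + Ln y) / 2))"
    using nz by (simp_all add: X_def powr_def field_simps flip: exp_add)
  have s: "sin (\<mu> * pi) \<noteq> 0"
  proof
    assume "sin (\<mu> * pi) = 0"
    then obtain i :: int where "\<mu> * pi = of_int i * pi" by (auto simp: sin_zero_iff_int2)
    thus False using \<mu>(3) by simp
  qed
  have "Bessel_I (- \<mu>) b - Bessel_I \<mu> b = X * macdonald_numerator \<mu> p y"
    using nz(3) by (simp add: I macdonald_numerator_def right_diff_distrib X mult.assoc[symmetric])
  also have "\<dots> = X * (of_real (sin (\<mu> * pi) / pi) * macdonald_integral \<mu> p y)"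
    by (subst macdonald_integral_conv_bessel_clifford[OF \<mu> p y]) simp
  finally show ?thesis using s by (simp add: X_def)
qed

lemma Bessel_K_eq_macdonald_integral:
  assumes \<nu>: "\<nu> = 0 \<or> \<nu> = 1" and p: "Re p > 0" and y: "Re y > 0"
  shows "Bessel_K \<nu> (csqrt (2 * p) * csqrt (2 * y)) =
         exp (of_real \<nu> * ((Ln p - Ln y) / 2)) * macdonald_integral \<nu> p y / 2"
proof -
  define b where "b = csqrt (2 * p) * csqrt (2 * y)"
  define f where "f = (\<lambda>\<mu>. of_real pi / 2 * (Bessel_I (-\<mu>) b - Bessel_I \<mu> b) / of_real (sin (\<mu> * pi)))"
  define g where "g = (\<lambda>\<mu>. exp (of_real \<mu> * ((Ln p - Ln y) / 2)) * macdonald_integral \<mu> p y / 2)"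
  have "(g \<longlongrightarrow> g \<nu>) (at \<nu>)"
    unfolding g_def using isCont_macdonald_integral_order[OF p y, of \<nu>]
    by (intro tendsto_intros) (auto simp: isCont_def)
  moreover have "eventually (\<lambda>\<mu>. g \<mu> = f \<mu>) (at \<nu>)"
  proof -
    have "eventually (\<lambda>\<mu>. \<mu> \<in> {\<nu> - 1<..<\<nu> + 1} - {\<nu>}) (at \<nu>)"
      by (intro eventually_at_in_open) auto
    thus ?thesis
    proof eventually_elim
      case (elim \<mu>)
      have "\<mu> \<notin> \<int>" "- 1 < \<mu>" "\<mu> < 2" using elim \<nu> by (auto elim!: Ints_cases)
      thus ?case using Bessel_I_quotient_eq_macdonald_integral[of \<mu> p y] p y
        by (simp add: f_def g_def b_def)
    qed
  qed
  ultimately have "(f \<longlongrightarrow> g \<nu>) (at \<nu>)" by (rule Lim_transform_eventually)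
  hence "Lim (at \<nu>) f = g \<nu>" by (intro tendsto_Lim) auto
  moreover have "\<nu> \<in> \<int>" using \<nu> by auto
  ultimately show ?thesis by (simp add: Bessel_K_def f_def g_def b_def Let_def)
qed

lemma Bessel_K_0_eq_macdonald_integral:
  assumes "Re p > 0" "Re y > 0"
  shows "Bessel_K 0 (csqrt (2 * p) * csqrt (2 * y)) = macdonald_integral 0 p y / 2"
  using Bessel_K_eq_macdonald_integral[of 0 p y] assms by simp

lemma Bessel_K_1_eq_macdonald_integral:
  assumes p: "Re p > 0" and y: "Re y > 0"
  defines "b \<equiv> csqrt (2 * p) * csqrt (2 * y)"
  shows "Bessel_K 1 b = b / (4 * y) * macdonald_integral 1 p y"
proof -
  have nz: "y \<noteq> 0" using y by auto
  have "exp ((Ln p - Ln y) / 2) = exp ((Ln p + Ln y) / 2) / exp (Ln y)"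
    by (simp flip: exp_diff add: field_simps)
  also have "\<dots> = b / 2 / y"
    using csqrt_mult_csqrt_Ln(1)[OF p y] nz by (simp add: b_def)
  finally show ?thesis using Bessel_K_eq_macdonald_integral[of 1 p y] p y by (simp add: b_def)
qed

section \<open>Expansion in Laguerre polynomials\<close>

definition laguerre_coeff :: "nat \<Rightarrow> nat \<Rightarrow> nat \<Rightarrow> complex" where
  "laguerre_coeff \<nu> n j = (if j \<le> n then 1 / (fact j * fact (\<nu> + j) * fact (n - j)) else 0)"

text \<open>
  The generalized Laguerre polynomial \<open>L\<^sub>n\<^bsup>(\<nu>)\<^esup>(z)\<close> divided by \<open>(n + \<nu>)!\<close>.  With this normalization the
  generating function below is a plain power series in \<open>w\<close>.
\<close>

definition laguerre :: "nat \<Rightarrow> nat \<Rightarrow> complex \<Rightarrow> complex" where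
  "laguerre \<nu> n z = (\<Sum>j\<le>n. laguerre_coeff \<nu> n j * (- z) ^ j)"

lemma bessel_clifford_of_nat_sums:
  "(\<lambda>m. w ^ m / (fact m * fact (\<nu> + m))) sums bessel_clifford (real \<nu>) w"
proof -
  have "rGamma (of_real (real \<nu>) + of_nat m + 1) = (1 / fact (\<nu> + m) :: complex)" for m
    using Gamma_fact[of "\<nu> + m", where ?'a = complex]
    by (simp add: rGamma_inverse_Gamma add_ac inverse_eq_divide)
  hence "(\<lambda>m. rGamma (of_real (real \<nu>) + of_nat m + 1) / fact m * w ^ m) = (\<lambda>m. w ^ m / (fact m * fact (\<nu> + m)))"
    by (intro ext) (simp only:, simp add: mult_ac)
  thus ?thesis using summable_bessel_clifford[of "real \<nu>" w]
    by (simp add: bessel_clifford_def summable_sums)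
qed

lemma summable_norm_bessel_clifford_of_nat:
  "summable (\<lambda>m. norm ((w::complex) ^ m / (fact m * fact (\<nu> + m))))"
proof (rule summable_comparison_test')
  show "summable (\<lambda>m. norm w ^ m / fact m)"
    using summable_exp[of "norm w"] by (simp add: field_simps)
  fix m :: nat
  have "norm w ^ m / (fact m * fact (\<nu> + m)) \<le> norm w ^ m / (fact m * 1)"
    by (intro divide_left_mono mult_left_mono mult_pos_pos) auto
  thus "norm (norm (w ^ m / (fact m * fact (\<nu> + m)))) \<le> norm w ^ m / fact m"
    by (simp add: norm_divide norm_mult norm_power)
qed

lemma laguerre_generating_function:
  "(\<lambda>n. w ^ n * laguerre \<nu> n z) sums (exp w * bessel_clifford (real \<nu>) (- (z * w)))"
proof -
  have "(\<lambda>k. \<Sum>i\<le>k. ((- (z * w)) ^ i / (fact i * fact (\<nu> + i))) * (w ^ (k - i) /\<^sub>R fact (k - i))) sums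
      ((\<Sum>m. (- (z * w)) ^ m / (fact m * fact (\<nu> + m))) * (\<Sum>m. w ^ m /\<^sub>R fact m))"
    by (intro Cauchy_product_sums summable_norm_bessel_clifford_of_nat summable_norm_exp)
  also have "(\<Sum>m. (- (z * w)) ^ m / (fact m * fact (\<nu> + m))) = bessel_clifford (real \<nu>) (- (z * w))"
    by (rule sums_unique[symmetric]) (rule bessel_clifford_of_nat_sums)
  also have "(\<Sum>m. w ^ m /\<^sub>R fact m) = exp w" by (simp add: exp_def)
  also have "(\<lambda>k. \<Sum>i\<le>k. ((- (z * w)) ^ i / (fact i * fact (\<nu> + i))) * (w ^ (k - i) /\<^sub>R fact (k - i))) =
             (\<lambda>n. w ^ n * laguerre \<nu> n z)"
  proof
    fix n
    have "((- (z * w)) ^ i / (fact i * fact (\<nu> + i))) * (w ^ (n - i) /\<^sub>R fact (n - i)) =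
          w ^ n * (laguerre_coeff \<nu> n i * (- z) ^ i)" if "i \<le> n" for i
    proof -
      have w: "w ^ n = w ^ i * w ^ (n - i)" using that by (simp flip: power_add)
      have z: "(- (z * w)) ^ i = (- z) ^ i * w ^ i" by (simp flip: power_mult_distrib)
      show ?thesis unfolding w z using that
        by (simp add: laguerre_coeff_def scaleR_conv_of_real field_simps)
    qed
    thus "(\<Sum>i\<le>n. ((- (z * w)) ^ i / (fact i * fact (\<nu> + i))) * (w ^ (n - i) /\<^sub>R fact (n - i))) = w ^ n * laguerre \<nu> n z"
      unfolding laguerre_def sum_distrib_left by (intro sum.cong) auto
  qed
  finally show ?thesis by (simp add: mult.commute)
qed

text \<open>
  From \<open>z\<^sup>j/j! \<le> 4\<^sup>j e\<^bsup>z/4\<^esup>\<close> and \<open>\<Sum>\<^sub>j (n choose j) 4\<^sup>j = 5\<^sup>n\<close>.  What matters is the exponent \<open>1/4\<close>: it is less than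
  \<open>1\<close>, so that the generating series with a small parameter stays integrable against \<open>e\<^bsup>-z\<^esup>\<close>.
\<close>

lemma norm_laguerre_le:
  assumes "z \<ge> (0::real)"
  shows "norm (laguerre \<nu> n (of_real z)) \<le> 5 ^ n * exp (z / 4) / fact n"
proof -
  have pw: "z ^ j / fact j \<le> 4 ^ j * exp (z / 4)" for j
  proof -
    have "(z / 4) ^ j / fact j \<le> exp (z / 4)"
    proof -
      have "(\<lambda>m. (z / 4) ^ m /\<^sub>R fact m) sums exp (z / 4)" by (rule exp_converges)
      moreover have "(\<Sum>m\<in>{j}. (z / 4) ^ m /\<^sub>R fact m) \<le> (\<Sum>m. (z / 4) ^ m /\<^sub>R fact m)"
        by (rule sum_le_suminf[OF summable_exp_generic]) (use assms in auto)
      ultimately show ?thesis by (simp add: sums_iff field_simps)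
    qed
    hence "4 ^ j * ((z / 4) ^ j / fact j) \<le> 4 ^ j * exp (z / 4)"
      by (rule mult_left_mono) auto
    thus ?thesis by (simp add: power_divide)
  qed
  have "norm (laguerre \<nu> n (of_real z)) \<le> (\<Sum>j\<le>n. norm (laguerre_coeff \<nu> n j * (- of_real z) ^ j))"
    unfolding laguerre_def by (rule norm_sum)
  also have "\<dots> \<le> (\<Sum>j\<le>n. of_nat (n choose j) * 4 ^ j * (exp (z / 4) / fact n))"
  proof (rule sum_mono)
    fix j assume "j \<in> {..n}"
    hence j: "j \<le> n" by simp
    have "norm (laguerre_coeff \<nu> n j * (- of_real z) ^ j) = z ^ j / (fact j * fact (\<nu> + j) * fact (n - j))"
      using j assms by (simp add: laguerre_coeff_def norm_mult norm_divide norm_power)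
    also have "\<dots> \<le> z ^ j / (fact j * fact j * fact (n - j))"
      using assms by (intro divide_left_mono mult_right_mono mult_left_mono fact_mono mult_pos_pos) auto
    also have "\<dots> = (of_nat (n choose j) / fact n) * (z ^ j / fact j)"
      using j by (simp add: binomial_fact field_simps)
    also have "\<dots> \<le> (of_nat (n choose j) / fact n) * (4 ^ j * exp (z / 4))"
      by (intro mult_left_mono pw) auto
    finally show "norm (laguerre_coeff \<nu> n j * (- of_real z) ^ j) \<le> of_nat (n choose j) * 4 ^ j * (exp (z / 4) / fact n)"
      by (simp add: field_simps)
  qed
  also have "\<dots> = (4 + 1) ^ n * (exp (z / 4) / fact n)"
    by (simp only: binomial_ring sum_distrib_right power_one mult_1_right)
  finally show ?thesis by simp
qed

text \<open>
  This is \<open>(n + 1) L\<^bsub>n+1\<^esub> = (n + 1 + \<nu> - z) L\<^sub>n + z L\<^sub>n'\<close> for the Laguerre polynomials of parameter \<open>\<nu>\<close>, read off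
  coefficientwise.
\<close>

lemma laguerre_coeff_recurrence:
  "of_nat ((n + 1) * (n + 1 + \<nu>)) * laguerre_coeff \<nu> (Suc n) j =
     of_nat (\<nu> + n + j + 1) * laguerre_coeff \<nu> n j + (if j = 0 then 0 else laguerre_coeff \<nu> n (j - 1))"
proof (cases j)
  case 0
  have "laguerre_coeff \<nu> (Suc n) 0 = 1 / (fact \<nu> * (of_nat (Suc n) * fact n))" "laguerre_coeff \<nu> n 0 = 1 / (fact \<nu> * fact n)"
    by (simp_all add: laguerre_coeff_def)
  moreover have "of_nat ((n + 1) * (n + 1 + \<nu>)) = (of_nat (Suc n) * of_nat (\<nu> + n + 0 + 1) :: complex)"
    by (simp add: algebra_simps)
  moreover have "of_nat (Suc n) \<noteq> (0::complex)" by (rule of_nat_neq_0)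
  ultimately show ?thesis using 0
    by (simp del: of_nat_Suc of_nat_add)
next
  case (Suc i)
  consider "Suc i \<le> n" | "i = n" | "i > n" by linarith
  thus ?thesis
  proof cases
    case 1
    then obtain m where m: "n = Suc i + m" using le_Suc_ex by blast
    have 2: "laguerre_coeff \<nu> (Suc n) j = 1 / (of_nat (Suc i) * fact i * (of_nat (Suc (\<nu> + i)) * fact (\<nu> + i)) * (of_nat (Suc m) * fact m))"
      "laguerre_coeff \<nu> n j = 1 / (of_nat (Suc i) * fact i * (of_nat (Suc (\<nu> + i)) * fact (\<nu> + i)) * fact m)"
      "laguerre_coeff \<nu> n (j - 1) = 1 / (fact i * fact (\<nu> + i) * (of_nat (Suc m) * fact m))"
      by (simp_all add: laguerre_coeff_def Suc m del: of_nat_Suc)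
    define a b c :: complex where "a = of_nat (Suc i)" and "b = of_nat (Suc (\<nu> + i))" and "c = of_nat (Suc m)"
    have nz: "a \<noteq> 0" "b \<noteq> 0" "c \<noteq> 0" unfolding a_def b_def c_def by (rule of_nat_neq_0)+
    have e: "of_nat ((n + 1) * (n + 1 + \<nu>)) = (a + c) * (b + c)" "of_nat (\<nu> + n + j + 1) = a + b + c"
      by (simp_all add: a_def b_def c_def m Suc algebra_simps)
    have "of_nat ((n + 1) * (n + 1 + \<nu>)) * laguerre_coeff \<nu> (Suc n) j =
          of_nat (\<nu> + n + j + 1) * laguerre_coeff \<nu> n j + laguerre_coeff \<nu> n (j - 1)"
      unfolding 2 e a_def[symmetric] b_def[symmetric] c_def[symmetric] using nz
      by (simp add: field_simps)
    moreover have "j \<noteq> 0" using Suc by simp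
    ultimately show ?thesis by (simp only: if_False)
  next
    case 2
    have nz: "of_nat (Suc k) \<noteq> (0::complex)" for k by (rule of_nat_neq_0)
    have "laguerre_coeff \<nu> (Suc n) j = 1 / (of_nat (n + 1) * fact n * (of_nat (n + 1 + \<nu>) * fact (\<nu> + n)))"
      "laguerre_coeff \<nu> n j = 0" "laguerre_coeff \<nu> n (j - 1) = 1 / (fact n * fact (\<nu> + n))"
      by (simp_all add: laguerre_coeff_def Suc 2 add_ac)
    moreover have "of_nat (n + 1) \<noteq> (0::complex)" "of_nat (n + 1 + \<nu>) \<noteq> (0::complex)"
      using nz[of n] nz[of "n + \<nu>"] by simp_all
    ultimately show ?thesis unfolding of_nat_mult using Suc by (simp del: of_nat_add of_nat_Suc)
  next
    case 3
    thus ?thesis using Suc by (simp add: laguerre_coeff_def)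
  qed
qed

text \<open>
  The left-hand side is \<open>T\<^sub>n = \<integral> t\<^bsup>n+\<nu>-1\<^esup> e\<^bsup>-yt-p/t\<^esup> laguerre \<nu> n (yt) dt\<close>.  With \<open>f\<^sub>n(t) = t\<^bsup>n+\<nu>+1\<^esup> e\<^bsup>-yt\<^esup> laguerre \<nu> n (yt)\<close>
  one has \<open>t\<^sup>2 f\<^sub>n' = (n + 1) (n + 1 + \<nu>) f\<^bsub>n+1\<^esub>\<close>, and integration by parts against \<open>e\<^bsup>-p/t\<^esup>\<close> turns the
  derivative into the factor \<open>- p/t\<^sup>2\<close>; hence \<open>(n + 1) (n + 1 + \<nu>) T\<^bsub>n+1\<^esub> = - p T\<^sub>n\<close>.  Below, the
  integration by parts is the three-term recurrence of the Macdonald integral, applied to each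
  coefficient.
\<close>

lemma macdonald_integral_laguerre_sum:
  assumes p: "Re p > 0" and y: "Re y > 0"
  shows "(\<Sum>j\<le>n. laguerre_coeff \<nu> n j * (- y) ^ j * macdonald_integral (- real (\<nu> + n + j)) p y) =
           (- p) ^ n / (fact n * fact (\<nu> + n)) * macdonald_integral (- real \<nu>) p y"
proof (induction n)
  case 0
  show ?case by (simp add: laguerre_coeff_def)
next
  case (Suc n)
  define A where "A = (\<lambda>m. macdonald_integral (- real (\<nu> + m)) p y)"
  define x where "x = (\<lambda>j. (- y) ^ j * A (n + 1 + j))"
  have A: "p * A m = y * A (m + 2) - of_nat (\<nu> + m + 1) * A (m + 1)" for m
  proof -
    have idx: "- real (\<nu> + m + 1) + 1 = - real (\<nu> + m)" "- real (\<nu> + m + 1) - 1 = - real (\<nu> + (m + 2))"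
      by simp_all
    show ?thesis
      using macdonald_integral_recurrence[OF p y, of "- real (\<nu> + m + 1)", unfolded idx]
      by (simp add: A_def add_ac del: of_nat_Suc of_nat_add)
  qed
  define S where "S = (\<lambda>n. \<Sum>j\<le>n. laguerre_coeff \<nu> n j * (- y) ^ j * A (n + j))"
  have "- p * S n = (\<Sum>j\<le>n. of_nat (\<nu> + n + j + 1) * laguerre_coeff \<nu> n j * x j + laguerre_coeff \<nu> n j * x (Suc j))"
    unfolding S_def sum_distrib_left
  proof (rule sum.cong)
    fix j
    have "- p * (laguerre_coeff \<nu> n j * (- y) ^ j * A (n + j)) = - (laguerre_coeff \<nu> n j * (- y) ^ j * (p * A (n + j)))"
      by simp
    also have "\<dots> = of_nat (\<nu> + n + j + 1) * laguerre_coeff \<nu> n j * x j + laguerre_coeff \<nu> n j * x (Suc j)"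
      unfolding A x_def by (simp add: algebra_simps)
    finally show "- p * (laguerre_coeff \<nu> n j * (- y) ^ j * A (n + j)) = of_nat (\<nu> + n + j + 1) * laguerre_coeff \<nu> n j * x j + laguerre_coeff \<nu> n j * x (Suc j)" .
  qed simp
  also have "\<dots> = (\<Sum>j\<le>n. of_nat (\<nu> + n + j + 1) * laguerre_coeff \<nu> n j * x j) + (\<Sum>j\<le>n. laguerre_coeff \<nu> n j * x (Suc j))"
    by (rule sum.distrib)
  also have "(\<Sum>j\<le>n. of_nat (\<nu> + n + j + 1) * laguerre_coeff \<nu> n j * x j) =
             (\<Sum>j\<le>Suc n. of_nat (\<nu> + n + j + 1) * laguerre_coeff \<nu> n j * x j)"
    by (simp add: laguerre_coeff_def[of _ _ "Suc n"])
  also have "(\<Sum>j\<le>n. laguerre_coeff \<nu> n j * x (Suc j)) = (\<Sum>j\<le>Suc n. (if j = 0 then 0 else laguerre_coeff \<nu> n (j - 1)) * x j)"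
    by (subst sum.atMost_Suc_shift) simp
  also have "(\<Sum>j\<le>Suc n. of_nat (\<nu> + n + j + 1) * laguerre_coeff \<nu> n j * x j) + \<dots> =
      (\<Sum>j\<le>Suc n. of_nat ((n + 1) * (n + 1 + \<nu>)) * (laguerre_coeff \<nu> (Suc n) j * x j))"
    unfolding sum.distrib[symmetric]
  proof (rule sum.cong)
    fix j
    show "of_nat (\<nu> + n + j + 1) * laguerre_coeff \<nu> n j * x j + (if j = 0 then 0 else laguerre_coeff \<nu> n (j - 1)) * x j =
         of_nat ((n + 1) * (n + 1 + \<nu>)) * (laguerre_coeff \<nu> (Suc n) j * x j)"
      unfolding mult.assoc[symmetric] laguerre_coeff_recurrence by (simp add: distrib_right)
  qed simp
  also have "\<dots> = of_nat ((n + 1) * (n + 1 + \<nu>)) * S (Suc n)"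
    by (simp add: S_def x_def mult.assoc sum_distrib_left del: sum.atMost_Suc)
  finally have rec: "of_nat ((n + 1) * (n + 1 + \<nu>)) * S (Suc n) = - p * S n" by simp
  have "of_nat ((n + 1) * (n + 1 + \<nu>)) \<noteq> (0::complex)"
    by (simp only: of_nat_eq_0_iff) simp
  hence "S (Suc n) = - p * S n / of_nat ((n + 1) * (n + 1 + \<nu>))"
    using rec by (metis nonzero_mult_div_cancel_left)
  also have "S n = (- p) ^ n / (fact n * fact (\<nu> + n)) * A 0"
    using Suc.IH by (simp only: S_def A_def add.assoc add_0_right)
  also have "- p * ((- p) ^ n / (fact n * fact (\<nu> + n)) * A 0) / of_nat ((n + 1) * (n + 1 + \<nu>)) =
       (- p) ^ Suc n / (fact (Suc n) * fact (\<nu> + Suc n)) * A 0"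
  proof -
    have "of_nat ((n + 1) * (n + 1 + \<nu>)) = (of_nat (Suc n) * of_nat (Suc (\<nu> + n)) :: complex)"
      by (simp only: of_nat_mult[symmetric]) (simp add: add_ac)
    thus "- p * ((- p) ^ n / (fact n * fact (\<nu> + n)) * A 0) / of_nat ((n + 1) * (n + 1 + \<nu>)) =
       (- p) ^ Suc n / (fact (Suc n) * fact (\<nu> + Suc n)) * A 0"
      by (simp only: add_Suc_right fact_Suc) (simp add: mult_ac del: of_nat_Suc)
  qed
  finally have "S (Suc n) = (- p) ^ Suc n / (fact (Suc n) * fact (\<nu> + Suc n)) * A 0" .
  thus ?case by (simp only: S_def A_def add.assoc add_0_right)
qed

text \<open>
  Write \<open>e\<^bsup>Xt\<^esup> bessel_clifford \<nu> (- XYt\<^sup>2)\<close> as the Laguerre generating function with \<open>w = Xt\<close>, \<open>z = Yt\<close> and integrate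
  term by term: the moments computed above turn the series in \<open>X\<close> into that of
  \<open>bessel_clifford \<nu> (- pX)\<close>.  The condition \<open>20 X \<le> Y\<close> makes the bounds for the terms sum to at most
  \<open>e\<^bsup>5Xt + Yt/4\<^esup> \<le> e\<^bsup>Yt/2\<^esup>\<close>, which costs half of the available decay.
\<close>

lemma integral_bessel_clifford_eq_product:
  fixes X Y :: real and p :: complex
  assumes p: "Re p > 0" and XY: "X \<ge> 0" "Y > 0" "20 * X \<le> Y"
  shows "(\<integral>t. of_real (t powr (real \<nu> - 1)) * exp (- (of_real (Y - X) * of_real t) - p / of_real t)
              * bessel_clifford (real \<nu>) (- of_real (X * Y * t\<^sup>2)) \<partial>pos_lborel) =
         bessel_clifford (real \<nu>) (- (p * of_real X)) * macdonald_integral (- real \<nu>) p (of_real Y)"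
proof -
  define e where "e = (\<lambda>m t. of_real (t powr m) * exp (- (of_real Y * of_real t) - p / of_real t) :: complex)"
  define s where "s = (\<lambda>N t. \<Sum>n<N. (of_real (X * t)) ^ n * laguerre \<nu> n (of_real (Y * t)) * e (real \<nu> - 1) t)"
  have Y: "Re (of_real Y :: complex) > 0" using XY by simp
  have ie: "integrable pos_lborel (e m)" for m
    unfolding e_def by (rule macdonald_integral_integrable[OF p Y])
  have K: "macdonald_integral (- real m) p (of_real Y) = (\<integral>t. e (real m - 1) t \<partial>pos_lborel)" for m
    by (simp add: macdonald_integral_def e_def)
  have int_s: "(\<integral>t. s N t \<partial>pos_lborel) =
      (\<Sum>n<N. (- (p * of_real X)) ^ n / (fact n * fact (\<nu> + n)) * macdonald_integral (- real \<nu>) p (of_real Y))" for N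
  proof -
    have "(\<integral>t. s N t \<partial>pos_lborel) = (\<integral>t. (\<Sum>n<N. \<Sum>j\<le>n. of_real X ^ n * (laguerre_coeff \<nu> n j * (- of_real Y) ^ j) * e (real (\<nu> + n + j) - 1) t) \<partial>pos_lborel)"
    proof (rule integral_pos_lborel_cong)
      fix t :: real assume t: "t > 0"
      have "of_real t ^ n * of_real t ^ j * e (real \<nu> - 1) t = e (real (\<nu> + n + j) - 1) t" for n j
      proof -
        have "t powr (real (\<nu> + n + j) - 1) = t powr (real \<nu> - 1) * t powr (real n + real j)"
          by (simp flip: powr_add add: algebra_simps)
        also have "t powr (real n + real j) = t ^ n * t ^ j"
          using t by (simp add: powr_add powr_realpow)
        finally show ?thesis by (simp add: e_def mult_ac)
      qed
      note E = this[symmetric]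
      show "s N t = (\<Sum>n<N. \<Sum>j\<le>n. of_real X ^ n * (laguerre_coeff \<nu> n j * (- of_real Y) ^ j) * e (real (\<nu> + n + j) - 1) t)"
        unfolding s_def laguerre_def sum_distrib_left sum_distrib_right E
        by (intro sum.cong refl) (simp add: power_mult_distrib power_minus[of "of_real Y * of_real t"] power_minus[of "of_real Y"] mult_ac)
    qed
    also have "\<dots> = (\<Sum>n<N. \<Sum>j\<le>n. of_real X ^ n * (laguerre_coeff \<nu> n j * (- of_real Y) ^ j) * macdonald_integral (- real (\<nu> + n + j)) p (of_real Y))"
      unfolding K by (simp add: ie del: of_nat_add)
    also have "\<dots> = (\<Sum>n<N. of_real X ^ n * (\<Sum>j\<le>n. laguerre_coeff \<nu> n j * (- of_real Y) ^ j * macdonald_integral (- real (\<nu> + n + j)) p (of_real Y)))"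
      by (simp add: sum_distrib_left mult.assoc)
    also have "\<dots> = (\<Sum>n<N. (- (p * of_real X)) ^ n / (fact n * fact (\<nu> + n)) * macdonald_integral (- real \<nu>) p (of_real Y))"
      unfolding macdonald_integral_laguerre_sum[OF p Y]
    proof (rule sum.cong)
      fix n
      have "(- (p * of_real X)) ^ n = (- p) ^ n * of_real X ^ n" by (simp flip: power_mult_distrib)
      thus "of_real X ^ n * ((- p) ^ n / (fact n * fact (\<nu> + n)) * macdonald_integral (- real \<nu>) p (of_real Y)) =
        (- (p * of_real X)) ^ n / (fact n * fact (\<nu> + n)) * macdonald_integral (- real \<nu>) p (of_real Y)" by simp
    qed simp
    finally show ?thesis .
  qed
  have "(\<lambda>N. \<integral>t. s N t \<partial>pos_lborel) \<longlonglongrightarrow> bessel_clifford (real \<nu>) (- (p * of_real X)) * macdonald_integral (- real \<nu>) p (of_real Y)"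
    using sums_mult2[OF bessel_clifford_of_nat_sums, of "- (p * of_real X)" \<nu> "macdonald_integral (- real \<nu>) p (of_real Y)"]
    unfolding int_s sums_def .
  moreover have "(\<lambda>N. \<integral>t. s N t \<partial>pos_lborel) \<longlonglongrightarrow>
     (\<integral>t. of_real (t powr (real \<nu> - 1)) * exp (- (of_real (Y - X) * of_real t) - p / of_real t)
              * bessel_clifford (real \<nu>) (- of_real (X * Y * t\<^sup>2)) \<partial>pos_lborel)"
  proof (rule pos_lborel_dominated_convergence)
    show "integrable pos_lborel (\<lambda>t. t powr (real \<nu> - 1) * exp (- (Y / 2 * t) - Re p / t))"
      by (rule powr_mult_exp_integrable) (use p XY in auto)
    show "s N \<in> borel_measurable borel" for N
      unfolding s_def laguerre_def e_def by measurable
    fix t :: real assume t: "t > 0"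
    have "(\<lambda>N. s N t) \<longlonglongrightarrow> exp (of_real (X * t)) * bessel_clifford (real \<nu>) (- (of_real (Y * t) * of_real (X * t))) * e (real \<nu> - 1) t"
      using sums_mult2[OF laguerre_generating_function] unfolding s_def sums_def .
    also have "exp (of_real (X * t)) * bessel_clifford (real \<nu>) (- (of_real (Y * t) * of_real (X * t))) * e (real \<nu> - 1) t =
       of_real (t powr (real \<nu> - 1)) * exp (- (of_real (Y - X) * of_real t) - p / of_real t)
              * bessel_clifford (real \<nu>) (- of_real (X * Y * t\<^sup>2))"
    proof -
      have 1: "exp (- (of_real (Y - X) * of_real t) - p / of_real t) = exp (of_real (X * t)) * exp (- (of_real Y * of_real t) - p / of_real t)"
        by (simp flip: exp_add add: algebra_simps)
      have 2: "- (of_real (Y * t) * of_real (X * t)) = - (of_real (X * Y * t\<^sup>2) :: complex)"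
        by (simp add: power2_eq_square)
      show ?thesis unfolding 1 2 e_def by (simp only: mult_ac)
    qed
    finally show "(\<lambda>N. s N t) \<longlonglongrightarrow> of_real (t powr (real \<nu> - 1)) * exp (- (of_real (Y - X) * of_real t) - p / of_real t)
              * bessel_clifford (real \<nu>) (- of_real (X * Y * t\<^sup>2))" .
    fix N
    have ne: "norm (e (real \<nu> - 1) t) = t powr (real \<nu> - 1) * exp (- (Y * t) - Re p / t)"
      by (simp add: e_def norm_mult Re_divide_of_real)
    have "norm (s N t) \<le> (\<Sum>n<N. norm ((of_real (X * t)) ^ n * laguerre \<nu> n (of_real (Y * t)) * e (real \<nu> - 1) t))"
      unfolding s_def by (rule norm_sum)
    also have "\<dots> \<le> (\<Sum>n<N. (5 * X * t) ^ n / fact n * (exp (Y * t / 4) * norm (e (real \<nu> - 1) t)))"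
    proof (rule sum_mono)
      fix n
      have "norm ((of_real (X * t)) ^ n * laguerre \<nu> n (of_real (Y * t)) * e (real \<nu> - 1) t) =
         (X * t) ^ n * norm (laguerre \<nu> n (of_real (Y * t))) * norm (e (real \<nu> - 1) t)"
        using t XY by (simp add: norm_mult norm_power del: of_real_mult)
      also have "\<dots> \<le> (X * t) ^ n * (5 ^ n * exp (Y * t / 4) / fact n) * norm (e (real \<nu> - 1) t)"
        by (intro mult_right_mono mult_left_mono norm_laguerre_le) (use t XY in auto)
      finally show "norm ((of_real (X * t)) ^ n * laguerre \<nu> n (of_real (Y * t)) * e (real \<nu> - 1) t) \<le>
         (5 * X * t) ^ n / fact n * (exp (Y * t / 4) * norm (e (real \<nu> - 1) t))"
        by (simp add: power_mult_distrib mult_ac)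
    qed
    also have "\<dots> = (\<Sum>n<N. (5 * X * t) ^ n / fact n) * (exp (Y * t / 4) * norm (e (real \<nu> - 1) t))"
      by (simp add: sum_distrib_right)
    also have "\<dots> \<le> exp (5 * X * t) * (exp (Y * t / 4) * norm (e (real \<nu> - 1) t))"
    proof (rule mult_right_mono)
      have "(\<Sum>n<N. (5 * X * t) ^ n /\<^sub>R fact n) \<le> (\<Sum>n. (5 * X * t) ^ n /\<^sub>R fact n)"
        by (rule sum_le_suminf[OF summable_exp_generic]) (use t XY in auto)
      thus "(\<Sum>n<N. (5 * X * t) ^ n / fact n) \<le> exp (5 * X * t)" by (simp add: exp_def field_simps)
    qed auto
    also have "\<dots> = t powr (real \<nu> - 1) * exp (5 * X * t + Y * t / 4 - Y * t - Re p / t)"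
      unfolding ne by (simp flip: exp_add add: mult_ac)
    also have "\<dots> \<le> t powr (real \<nu> - 1) * exp (- (Y / 2 * t) - Re p / t)"
    proof -
      have "20 * X * t \<le> Y * t" using XY t by (intro mult_right_mono) auto
      thus ?thesis by (intro mult_left_mono) auto
    qed
    finally show "norm (s N t) \<le> t powr (real \<nu> - 1) * exp (- (Y / 2 * t) - Re p / t)" .
  qed measurable
  ultimately show ?thesis using LIMSEQ_unique by blast
qed

section \<open>Parabolic coordinates and the transform of J\<close>

text \<open>
  The parabolic coordinates \<open>x\<close>, \<open>y\<close> of \<open>(q, \<gamma>)\<close> are determined by \<open>y - x = q\<close>, \<open>4xy = \<gamma>\<^sup>2\<close>, and \<open>s = x + y\<close>.
  In the theorem the argument of \<open>J\<close> is \<open>2 \<surd>(px)\<close> and that of \<open>K\<close> is \<open>2 \<surd>(py)\<close>.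
\<close>

definition parabolic_s :: "real \<Rightarrow> complex \<Rightarrow> complex" where
  "parabolic_s \<gamma> q = csqrt (q\<^sup>2 + (of_real \<gamma>)\<^sup>2)"

definition parabolic_x :: "real \<Rightarrow> complex \<Rightarrow> complex" where
  "parabolic_x \<gamma> q = (parabolic_s \<gamma> q - q) / 2"

definition parabolic_y :: "real \<Rightarrow> complex \<Rightarrow> complex" where
  "parabolic_y \<gamma> q = (parabolic_s \<gamma> q + q) / 2"

lemma parabolic_x_mult_y: "parabolic_x \<gamma> q * parabolic_y \<gamma> q = (of_real \<gamma> / 2)\<^sup>2"
  and parabolic_x_add_y: "parabolic_x \<gamma> q + parabolic_y \<gamma> q = parabolic_s \<gamma> q"
proof -
  have "(parabolic_s \<gamma> q)\<^sup>2 = q\<^sup>2 + (of_real \<gamma>)\<^sup>2" by (simp add: parabolic_s_def)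
  thus "parabolic_x \<gamma> q * parabolic_y \<gamma> q = (of_real \<gamma> / 2)\<^sup>2"
    by (simp add: parabolic_x_def parabolic_y_def field_simps power2_eq_square)
qed (simp add: parabolic_x_def parabolic_y_def field_simps)

lemma
  assumes q: "Re q > 0"
  shows parabolic_radicand: "q\<^sup>2 + (of_real \<gamma>)\<^sup>2 \<notin> \<real>\<^sub>\<le>\<^sub>0"
    and Re_parabolic_s: "Re (parabolic_s \<gamma> q) > 0"
    and Re_parabolic_y: "Re (parabolic_y \<gamma> q) > 0"
proof -
  show *: "q\<^sup>2 + (of_real \<gamma>)\<^sup>2 \<notin> \<real>\<^sub>\<le>\<^sub>0"
  proof
    assume "q\<^sup>2 + (of_real \<gamma>)\<^sup>2 \<in> \<real>\<^sub>\<le>\<^sub>0"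
    hence "Re q * Im q = 0" "(Re q)\<^sup>2 - (Im q)\<^sup>2 + \<gamma>\<^sup>2 \<le> 0"
      by (auto simp: complex_nonpos_Reals_iff power2_eq_square)
    hence "(Re q)\<^sup>2 + \<gamma>\<^sup>2 \<le> 0" using q by auto
    moreover have "(Re q)\<^sup>2 > 0" using q by simp
    ultimately show False using zero_le_power2[of \<gamma>] by linarith
  qed
  have "Re (parabolic_s \<gamma> q) \<noteq> 0"
  proof
    assume "Re (parabolic_s \<gamma> q) = 0"
    hence "(parabolic_s \<gamma> q)\<^sup>2 \<in> \<real>\<^sub>\<le>\<^sub>0"
      by (auto simp: complex_nonpos_Reals_iff power2_eq_square)
    thus False using * by (simp add: parabolic_s_def)
  qed
  moreover have "Re (parabolic_s \<gamma> q) \<ge> 0" using Re_csqrt unfolding parabolic_s_def .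
  ultimately show s: "Re (parabolic_s \<gamma> q) > 0" by simp
  show "Re (parabolic_y \<gamma> q) > 0" using s q by (simp add: parabolic_y_def)
qed

lemma Re_parabolic_x:
  assumes q: "Re q > 0" and \<gamma>: "\<gamma> > 0"
  shows "Re (parabolic_x \<gamma> q) > 0"
proof -
  have y: "Re (parabolic_y \<gamma> q) > 0" by (rule Re_parabolic_y[OF q])
  hence "parabolic_y \<gamma> q \<noteq> 0" by auto
  hence "parabolic_x \<gamma> q = of_real ((\<gamma> / 2)\<^sup>2) * inverse (parabolic_y \<gamma> q)"
    using parabolic_x_mult_y[of \<gamma> q] by (simp add: field_simps)
  also have "Re \<dots> = (\<gamma> / 2)\<^sup>2 * Re (inverse (parabolic_y \<gamma> q))"
    by simp
  also have "\<dots> > 0"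
    using y \<gamma> \<open>parabolic_y \<gamma> q \<noteq> 0\<close> by (intro mult_pos_pos) (auto intro!: divide_pos_pos simp: complex_eq_iff sum_power2_gt_zero_iff)
  finally show ?thesis .
qed

lemma
  assumes q: "Re q > 0"
  shows has_field_derivative_parabolic_x:
    "(parabolic_x \<gamma> has_field_derivative - parabolic_x \<gamma> q / parabolic_s \<gamma> q) (at q)"
    and has_field_derivative_parabolic_y:
    "(parabolic_y \<gamma> has_field_derivative parabolic_y \<gamma> q / parabolic_s \<gamma> q) (at q)"
proof -
  have nz: "parabolic_s \<gamma> q \<noteq> 0" using Re_parabolic_s[OF q, of \<gamma>] by auto
  have s: "(parabolic_s \<gamma> has_field_derivative q / parabolic_s \<gamma> q) (at q)"
    unfolding parabolic_s_def
    by (rule DERIV_cong[OF DERIV_chain2[where f = csqrt and g = "\<lambda>q. q\<^sup>2 + (of_real \<gamma>)\<^sup>2", OF has_field_derivative_csqrt[OF parabolic_radicand[OF q]]]])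
       (auto intro!: derivative_eq_intros simp: field_simps)
  show "(parabolic_x \<gamma> has_field_derivative - parabolic_x \<gamma> q / parabolic_s \<gamma> q) (at q)"
    "(parabolic_y \<gamma> has_field_derivative parabolic_y \<gamma> q / parabolic_s \<gamma> q) (at q)"
    unfolding parabolic_x_def[abs_def] parabolic_y_def[abs_def]
    by (rule derivative_eq_intros s refl | use nz in \<open>simp add: field_simps\<close>)+
qed

text \<open>
  Each differentiation of \<open>\<integral> t\<^bsup>-1\<^esup> e\<^bsup>-qt-p/t\<^esup> J\<^sub>\<nu>(\<gamma>t) dt\<close> in \<open>q\<close> brings down a factor \<open>- t\<close>; \<open>m\<close> counts them.
\<close>

definition bessel_kernel :: "complex \<Rightarrow> real \<Rightarrow> nat \<Rightarrow> nat \<Rightarrow> real \<Rightarrow> complex" where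
  "bessel_kernel p \<gamma> \<nu> m t =
     (- of_real t) ^ m / of_real t * exp (- (p / of_real t)) * Bessel_J (real \<nu>) (of_real (\<gamma> * t))"

definition bessel_transform :: "complex \<Rightarrow> real \<Rightarrow> nat \<Rightarrow> nat \<Rightarrow> complex \<Rightarrow> complex" where
  "bessel_transform p \<gamma> \<nu> m q = (\<integral>t. exp (- (q * of_real t)) * bessel_kernel p \<gamma> \<nu> m t \<partial>pos_lborel)"

lemma measurable_bessel_kernel [measurable]:
  assumes "\<nu> \<in> {0, 1}"
  shows "bessel_kernel p \<gamma> \<nu> m \<in> borel_measurable borel"
proof -
  have "(\<lambda>t. Bessel_J (real \<nu>) (of_real (\<gamma> * t))) \<in> borel_measurable borel"
    using assms by (auto simp: Bessel_J_0 Bessel_J_1)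
  thus ?thesis unfolding bessel_kernel_def[abs_def] by measurable
qed

lemma norm_bessel_kernel_le:
  assumes "\<nu> \<in> {0, 1}" "\<gamma> \<ge> 0" "t > 0"
  shows "norm (bessel_kernel p \<gamma> \<nu> m t) \<le> t powr (real m - 1) * exp (- (Re p / t))"
proof -
  have J: "norm (Bessel_J (real \<nu>) (of_real (\<gamma> * t))) \<le> 1"
    using assms norm_Bessel_J_le_1[of "\<gamma> * t"] by auto
  have "norm (bessel_kernel p \<gamma> \<nu> m t) = t powr (real m - 1) * exp (- (Re p / t)) * norm (Bessel_J (real \<nu>) (of_real (\<gamma> * t)))"
    using assms by (simp add: bessel_kernel_def norm_mult norm_divide norm_power Re_divide_of_real powr_diff powr_realpow)
  also have "\<dots> \<le> t powr (real m - 1) * exp (- (Re p / t)) * 1"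
    by (rule mult_left_mono[OF J]) auto
  finally show ?thesis by simp
qed

lemma has_field_derivative_bessel_transform:
  assumes \<nu>: "\<nu> \<in> {0, 1}" and \<gamma>: "\<gamma> \<ge> 0" and p: "Re p > 0" and q: "Re q > 0"
  shows "(bessel_transform p \<gamma> \<nu> m has_field_derivative bessel_transform p \<gamma> \<nu> (Suc m) q) (at q)"
proof -
  have K: "- of_real t * bessel_kernel p \<gamma> \<nu> m t = bessel_kernel p \<gamma> \<nu> (Suc m) t" for t
    by (simp add: bessel_kernel_def)
  show ?thesis
    unfolding bessel_transform_def[abs_def] K[symmetric]
  proof (rule has_field_derivative_laplace_integral)
    fix \<sigma> :: real assume \<sigma>: "\<sigma> > 0"
    have "integrable pos_lborel (\<lambda>t. t powr (real m - 1) * exp (- (\<sigma> * t) - Re p / t))"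
      by (rule powr_mult_exp_integrable) (use p \<sigma> in auto)
    thus "integrable pos_lborel (\<lambda>t. exp (- (\<sigma> * t)) * norm (bessel_kernel p \<gamma> \<nu> m t))"
    proof (rule integrable_pos_lborel_bound)
      fix t :: real assume t: "t > 0"
      have "exp (- (\<sigma> * t)) * norm (bessel_kernel p \<gamma> \<nu> m t) \<le> exp (- (\<sigma> * t)) * (t powr (real m - 1) * exp (- (Re p / t)))"
        by (intro mult_left_mono norm_bessel_kernel_le \<nu> \<gamma> t) auto
      also have "\<dots> = t powr (real m - 1) * exp (- (\<sigma> * t) - Re p / t)"
        by (simp add: exp_diff exp_minus field_simps)
      finally show "norm (exp (- (\<sigma> * t)) * norm (bessel_kernel p \<gamma> \<nu> m t)) \<le> t powr (real m - 1) * exp (- (\<sigma> * t) - Re p / t)"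
        by simp
    qed (use \<nu> in measurable)
  qed (use \<nu> q in \<open>auto simp: space_pos_lborel intro!: borel_measurable_pos_lborel measurable_bessel_kernel\<close>)
qed

lemma bessel_kernel_conv_bessel_clifford:
  assumes "\<nu> \<in> {0, 1}" "t > 0"
  shows "bessel_kernel p \<gamma> \<nu> 0 t = (of_real \<gamma> / 2) ^ \<nu> * (of_real (t powr (real \<nu> - 1)) * exp (- (p / of_real t))
           * bessel_clifford (real \<nu>) (- of_real ((\<gamma> / 2)\<^sup>2 * t\<^sup>2)))"
  using assms by (auto simp: bessel_kernel_def Bessel_J_0 Bessel_J_1 power_mult_distrib power_divide powr_diff field_simps)

text \<open>
  Both sides are holomorphic for \<open>Re q > 0\<close>, the left-hand one because \<open>J\<^sub>0\<close> and \<open>J\<^sub>1\<close> are bounded on the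
  real line.  For real \<open>q \<ge> 3\<gamma>\<close> the coordinates are real with \<open>20 x \<le> y\<close>, where the
  Laguerre expansion applies.
\<close>

lemma bessel_transform_eq_product:
  assumes \<nu>: "\<nu> \<in> {0, 1}" and \<gamma>: "\<gamma> > 0" and p: "Re p > 0" and q: "Re q > 0"
  shows "bessel_transform p \<gamma> \<nu> 0 q = (of_real \<gamma> / 2) ^ \<nu> *
     (bessel_clifford (real \<nu>) (- (p * parabolic_x \<gamma> q)) * macdonald_integral (- real \<nu>) p (parabolic_y \<gamma> q))"
proof -
  define R where "R = (\<lambda>q. (of_real \<gamma> / 2) ^ \<nu> *
     (bessel_clifford (real \<nu>) (- (p * parabolic_x \<gamma> q)) * macdonald_integral (- real \<nu>) p (parabolic_y \<gamma> q)))"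
  define U where "U = complex_of_real ` {3 * \<gamma>..}"
  have "bessel_transform p \<gamma> \<nu> 0 q - R q = 0"
  proof (rule analytic_continuation[of "\<lambda>q. bessel_transform p \<gamma> \<nu> 0 q - R q" "{q. Re q > 0}" U "of_real (4 * \<gamma>)"])
    show "(\<lambda>q. bessel_transform p \<gamma> \<nu> 0 q - R q) holomorphic_on {q. Re q > 0}"
    proof (rule holomorphic_on_diff)
      show "bessel_transform p \<gamma> \<nu> 0 holomorphic_on {q. Re q > 0}"
        unfolding holomorphic_on_def field_differentiable_def
        using has_field_derivative_bessel_transform[OF \<nu> less_imp_le[OF \<gamma>] p] has_field_derivative_at_within by blast
      have "(R has_field_derivative (of_real \<gamma> / 2) ^ \<nu> *
         ((bessel_clifford (real \<nu> + 1) (- (p * parabolic_x \<gamma> q)) * - (p * (- parabolic_x \<gamma> q / parabolic_s \<gamma> q))) * macdonald_integral (- real \<nu>) p (parabolic_y \<gamma> q)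
          + (- macdonald_integral (- real \<nu> - 1) p (parabolic_y \<gamma> q) * (parabolic_y \<gamma> q / parabolic_s \<gamma> q)) * bessel_clifford (real \<nu>) (- (p * parabolic_x \<gamma> q)))) (at q)"
        if "Re q > 0" for q
        unfolding R_def
        by (intro DERIV_cmult DERIV_mult DERIV_minus DERIV_chain2[OF has_field_derivative_bessel_clifford] 
              DERIV_chain2[OF has_field_derivative_macdonald_integral] p Re_parabolic_y that
              has_field_derivative_parabolic_x has_field_derivative_parabolic_y)
      thus "R holomorphic_on {q. Re q > 0}"
        unfolding holomorphic_on_def field_differentiable_def
        using has_field_derivative_at_within by blast
    qed
    show "open {q. Re q > 0}" by (rule open_halfspace_Re_gt)
    show "connected {q. Re q > 0}" by (intro convex_connected convex_halfspace_Re_gt)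
    show "U \<subseteq> {q. Re q > 0}" using \<gamma> by (auto simp: U_def)
    show "complex_of_real (4 * \<gamma>) \<in> {q. Re q > 0}" using \<gamma> by simp
    show "complex_of_real (4 * \<gamma>) islimpt U"
      unfolding islimpt_approachable
    proof (intro allI impI)
      fix e :: real assume "e > 0"
      thus "\<exists>x'\<in>U. x' \<noteq> complex_of_real (4 * \<gamma>) \<and> dist x' (complex_of_real (4 * \<gamma>)) < e"
        using \<gamma> by (intro bexI[of _ "of_real (4 * \<gamma> + e / 2)"]) (auto simp: U_def dist_norm simp del: of_real_add of_real_mult simp flip: of_real_diff)
    qed
    show "q \<in> {q. Re q > 0}" using q by simp
    fix z assume "z \<in> U"
    then obtain x where x: "x \<ge> 3 * \<gamma>" "z = of_real x" by (auto simp: U_def)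
    define s where "s = sqrt (x\<^sup>2 + \<gamma>\<^sup>2)"
    have x0: "x > 0" using x \<gamma> by linarith
    have ps: "parabolic_s \<gamma> z = of_real s"
      unfolding parabolic_s_def x s_def by (simp flip: of_real_power of_real_add of_real_sqrt)
    have s1: "s \<ge> x" unfolding s_def by (rule real_le_rsqrt) simp
    \<comment> \<open>\<open>20 (s - x) \<le> s + x\<close> is equivalent to \<open>19 s \<le> 21 x\<close>\<close>
    have s2: "s \<le> 21 / 19 * x"
      unfolding s_def
    proof (rule real_le_lsqrt)
      have "(3 * \<gamma>)\<^sup>2 \<le> x\<^sup>2" by (intro power_mono) (use x \<gamma> in auto)
      hence "9 * \<gamma>\<^sup>2 \<le> x\<^sup>2" by (simp add: power_mult_distrib)
      thus "x\<^sup>2 + \<gamma>\<^sup>2 \<le> (21 / 19 * x)\<^sup>2"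
      proof -
        have "(21 / 19 * x)\<^sup>2 = 441 / 361 * x\<^sup>2" by (simp add: power_mult_distrib power_divide)
        thus ?thesis using zero_le_power2[of x] \<open>9 * \<gamma>\<^sup>2 \<le> x\<^sup>2\<close> by linarith
      qed
    qed (use x0 in auto)
    define X Y where "X = (s - x) / 2" and "Y = (s + x) / 2"
    have XY: "X \<ge> 0" "Y > 0" "20 * X \<le> Y" using s1 s2 x0 by (auto simp: X_def Y_def)
    have pxy: "parabolic_x \<gamma> z = of_real X" "parabolic_y \<gamma> z = of_real Y"
      by (simp_all add: parabolic_x_def parabolic_y_def x(2) ps[unfolded x(2)] X_def Y_def)
    have prod: "X * Y = (\<gamma> / 2)\<^sup>2"
    proof -
      have "complex_of_real (X * Y) = of_real ((\<gamma> / 2)\<^sup>2)"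
        using parabolic_x_mult_y[of \<gamma> z] by (simp add: pxy)
      thus ?thesis by (simp only: of_real_eq_iff)
    qed
    have diff: "Y - X = x" by (simp add: X_def Y_def field_simps)
    have "bessel_transform p \<gamma> \<nu> 0 z = (\<integral>t. (of_real \<gamma> / 2) ^ \<nu> * (of_real (t powr (real \<nu> - 1)) * exp (- (of_real (Y - X) * of_real t) - p / of_real t)
              * bessel_clifford (real \<nu>) (- of_real (X * Y * t\<^sup>2))) \<partial>pos_lborel)"
      unfolding bessel_transform_def
    proof (rule integral_pos_lborel_cong)
      fix t :: real assume t: "t > 0"
      have "exp (- (of_real (Y - X) * of_real t) - p / of_real t) = exp (- (z * of_real t)) * exp (- (p / of_real t))"
        unfolding diff x by (simp flip: exp_add)
      thus "exp (- (z * of_real t)) * bessel_kernel p \<gamma> \<nu> 0 t =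
         (of_real \<gamma> / 2) ^ \<nu> * (of_real (t powr (real \<nu> - 1)) * exp (- (of_real (Y - X) * of_real t) - p / of_real t)
              * bessel_clifford (real \<nu>) (- of_real (X * Y * t\<^sup>2)))"
        unfolding bessel_kernel_conv_bessel_clifford[OF \<nu> t] prod by (simp only: mult_ac)
    qed
    also have "\<dots> = R z"
      unfolding integral_mult_right_zero integral_bessel_clifford_eq_product[OF p XY] R_def pxy ..
    finally show "bessel_transform p \<gamma> \<nu> 0 z - R z = 0" by simp
  qed
  thus ?thesis by (simp add: R_def)
qed

text \<open>
  The geometric series \<open>\<Sum>\<^sub>k e\<^bsup>-(k+1)t\<^esup> = 1/(e\<^sup>t - 1)\<close> is what connects the Laplace transforms at the positive
  integers with the Mathieu integral.  Its singularity at \<open>t = 0\<close> is harmless because of \<open>e\<^bsup>-p/t\<^esup>\<close>.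
\<close>

lemma sums_bessel_transform:
  assumes \<nu>: "\<nu> \<in> {0, 1}" and \<gamma>: "\<gamma> \<ge> 0" and p: "Re p > 0"
  shows "(\<lambda>k. bessel_transform p \<gamma> \<nu> m (of_nat (Suc k))) sums
           (\<integral>t. bessel_kernel p \<gamma> \<nu> m t / of_real (exp t - 1) \<partial>pos_lborel)"
  unfolding sums_def
proof -
  define s where "s = (\<lambda>N t. \<Sum>k<N. exp (- (of_nat (Suc k) * of_real t)) * bessel_kernel p \<gamma> \<nu> m t)"
  have geom: "(\<lambda>k. exp (- (real (Suc k) * t))) sums (1 / (exp t - 1))" if t: "t > 0" for t
  proof -
    have "(\<lambda>k. exp (- t) * exp (- t) ^ k) sums (exp (- t) * (1 / (1 - exp (- t))))"
      by (intro sums_mult geometric_sums) (use t in auto)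
    moreover have "exp (- t) * (1 / (1 - exp (- t))) = 1 / (exp t - 1)"
      using t by (simp add: exp_minus field_simps)
    moreover have "exp (- t) * exp (- t) ^ k = exp (- (real (Suc k) * t))" for k
      by (simp add: algebra_simps flip: exp_add exp_of_nat_mult)
    ultimately show ?thesis by simp
  qed
  have expc: "exp (- (of_nat k * of_real t)) = (of_real (exp (- (real k * t))) :: complex)" for k t
    by (simp flip: exp_of_real)
  have s: "s N t = of_real (\<Sum>k<N. exp (- (real (Suc k) * t))) * bessel_kernel p \<gamma> \<nu> m t" for N t
    unfolding s_def expc of_real_sum sum_distrib_right ..
  have "(\<lambda>N. integral\<^sup>L pos_lborel (s N)) \<longlonglongrightarrow> (\<integral>t. bessel_kernel p \<gamma> \<nu> m t / of_real (exp t - 1) \<partial>pos_lborel)"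
  proof (rule pos_lborel_dominated_convergence)
    show "integrable pos_lborel (\<lambda>t. 2 * (t powr (real m - 2) * exp (- (1 / 2 * t) - Re p / t)))"
      by (intro integrable_mult_right powr_mult_exp_integrable) (use p in auto)
    show "s N \<in> borel_measurable borel" for N unfolding s_def using \<nu> by measurable
    fix t :: real assume t: "t > 0"
    have "(\<lambda>N. s N t) \<longlonglongrightarrow> of_real (1 / (exp t - 1)) * bessel_kernel p \<gamma> \<nu> m t"
      unfolding s using geom[OF t] by (intro tendsto_intros) (simp add: sums_def)
    thus "(\<lambda>N. s N t) \<longlonglongrightarrow> bessel_kernel p \<gamma> \<nu> m t / of_real (exp t - 1)"
      by (simp add: field_simps)
    fix N
    have "(\<Sum>k<N. exp (- (real (Suc k) * t))) \<le> 1 / (exp t - 1)"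
      using geom[OF t] by (intro sum_le_suminf[of _ "{..<N}", THEN order.trans]) (auto simp: sums_iff)
    also have "\<dots> \<le> 1 / (t / 2 * exp (t / 2))"
    proof (rule divide_left_mono)
      \<comment> \<open>factor \<open>e\<^sup>t - 1 = (e\<^bsup>t/2\<^esup> - 1) (e\<^bsup>t/2\<^esup> + 1)\<close>\<close>
      have "t / 2 \<le> exp (t / 2) - 1"
        using exp_ge_add_one_self[of "t / 2"] by linarith
      hence "t / 2 * exp (t / 2) \<le> (exp (t / 2) - 1) * (exp (t / 2) + 1)"
        using t by (intro mult_mono) auto
      also have "\<dots> = exp t - 1" by (simp add: algebra_simps flip: exp_add)
      finally show "t / 2 * exp (t / 2) \<le> exp t - 1" .
    qed (use t in auto)
    finally have S: "(\<Sum>k<N. exp (- (real (Suc k) * t))) \<le> 1 / (t / 2 * exp (t / 2))" .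
    have "norm (s N t) = (\<Sum>k<N. exp (- (real (Suc k) * t))) * norm (bessel_kernel p \<gamma> \<nu> m t)"
      unfolding s norm_mult norm_of_real by (simp add: sum_nonneg)
    also have "\<dots> \<le> 1 / (t / 2 * exp (t / 2)) * (t powr (real m - 1) * exp (- (Re p / t)))"
      by (intro mult_mono S norm_bessel_kernel_le \<nu> \<gamma> t) (use t in auto)
    also have "\<dots> = 2 * (t powr (real m - 2) * exp (- (1 / 2 * t) - Re p / t))"
    proof -
      have "exp (- (1 / 2 * t) - Re p / t) = inverse (exp (t / 2)) * exp (- (Re p / t))"
        by (simp flip: exp_add exp_minus)
      moreover have "t powr (real m - 1) = t powr (real m - 2) * t"
        using t by (simp add: powr_diff power2_eq_square)
      ultimately show ?thesis using t by (simp add: field_simps)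
    qed
    finally show "norm (s N t) \<le> 2 * (t powr (real m - 2) * exp (- (1 / 2 * t) - Re p / t))" .
  qed (use \<nu> in measurable)
  moreover have "integral\<^sup>L pos_lborel (s N) = (\<Sum>k<N. bessel_transform p \<gamma> \<nu> m (of_nat (Suc k)))" for N
  proof -
    have "integrable pos_lborel (\<lambda>t. exp (- (of_nat (Suc k) * of_real t)) * bessel_kernel p \<gamma> \<nu> m t)" for k
    proof (rule integrable_pos_lborel_bound[OF powr_mult_exp_integrable[of "Re p" 1 "real m - 1"]])
      fix t :: real assume t: "t > 0"
      have "norm (exp (- (of_nat (Suc k) * of_real t)) * bessel_kernel p \<gamma> \<nu> m t)
         \<le> exp (- t) * (t powr (real m - 1) * exp (- (Re p / t)))"
        unfolding norm_mult by (intro mult_mono norm_bessel_kernel_le \<nu> \<gamma> t) (use t in auto)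
      also have "\<dots> = t powr (real m - 1) * exp (- (1 * t) - Re p / t)"
        by (simp add: exp_diff exp_minus field_simps)
      finally show "norm (exp (- (of_nat (Suc k) * of_real t)) * bessel_kernel p \<gamma> \<nu> m t) \<le> t powr (real m - 1) * exp (- (1 * t) - Re p / t)" .
    qed (use p \<nu> in \<open>auto intro!: borel_measurable_times measurable_bessel_kernel\<close>)
    thus ?thesis unfolding s_def bessel_transform_def by (rule Bochner_Integration.integral_sum)
  qed
  ultimately show "(\<lambda>N. \<Sum>k<N. bessel_transform p \<gamma> \<nu> m (of_nat (Suc k))) \<longlonglongrightarrow>
       (\<integral>t. bessel_kernel p \<gamma> \<nu> m t / of_real (exp t - 1) \<partial>pos_lborel)" by simp
qed

section \<open>The Mathieu series\<close>

text \<open>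
  The square of the product is \<open>\<gamma>\<^sup>2\<close>; its sign is decided by the real part, which is positive because
  both radicands lie in the right half-plane.
\<close>

lemma csqrt_parabolic_mult:
  assumes q: "Re q > 0" and \<gamma>: "\<gamma> > 0"
  shows "csqrt (2 * parabolic_x \<gamma> q) * csqrt (2 * parabolic_y \<gamma> q) = of_real \<gamma>"
proof -
  define w where "w = csqrt (2 * parabolic_x \<gamma> q) * csqrt (2 * parabolic_y \<gamma> q)"
  have x: "Re (parabolic_x \<gamma> q) > 0" and y: "Re (parabolic_y \<gamma> q) > 0"
    using Re_parabolic_x Re_parabolic_y q \<gamma> by auto
  have nz: "parabolic_x \<gamma> q \<noteq> 0" "parabolic_y \<gamma> q \<noteq> 0" using x y by auto
  have "\<bar>Im (Ln (w / 2))\<bar> < pi / 2"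
    using Re_Ln_pos_lt[OF nz(1)] Re_Ln_pos_lt[OF nz(2)] x y
    unfolding w_def csqrt_mult_csqrt_Ln(2)[OF x y] by simp
  hence "Re w > 0" using Re_Ln_pos_lt[of "w / 2"] nz by (simp add: w_def)
  moreover have "w\<^sup>2 = (of_real \<gamma>)\<^sup>2"
    using parabolic_x_mult_y[of \<gamma> q] by (simp add: w_def power_mult_distrib power_divide mult_ac)
  hence "w = of_real \<gamma> \<or> w = - of_real \<gamma>" by (simp add: power2_eq_iff)
  ultimately have "w = of_real \<gamma>" using \<gamma> by auto
  thus ?thesis by (simp only: w_def)
qed

context
  fixes p :: complex and \<gamma> :: real and a b :: "complex \<Rightarrow> complex"
  assumes p: "Re p > 0" and \<gamma>: "\<gamma> > 0"
  defines "a \<equiv> \<lambda>q. csqrt (2 * p) * csqrt (csqrt (q\<^sup>2 + (of_real \<gamma>)\<^sup>2) - q)"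
    and "b \<equiv> \<lambda>q. csqrt (2 * p) * csqrt (csqrt (q\<^sup>2 + (of_real \<gamma>)\<^sup>2) + q)"
begin

lemma bessel_arguments:
  assumes q: "Re q > 0"
  shows "(a q / 2)\<^sup>2 = p * parabolic_x \<gamma> q" "(b q / 2)\<^sup>2 = p * parabolic_y \<gamma> q"
    "a q * b q = 2 * p * of_real \<gamma>" "a q \<noteq> 0" "b q \<noteq> 0"
    "b q = csqrt (2 * p) * csqrt (2 * parabolic_y \<gamma> q)"
proof -
  have a: "a q = csqrt (2 * p) * csqrt (2 * parabolic_x \<gamma> q)" and b: "b q = csqrt (2 * p) * csqrt (2 * parabolic_y \<gamma> q)"
  proof -
    have "2 * parabolic_x \<gamma> q = parabolic_s \<gamma> q - q" "2 * parabolic_y \<gamma> q = parabolic_s \<gamma> q + q"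
      by (simp_all add: parabolic_x_def parabolic_y_def field_simps)
    thus "a q = csqrt (2 * p) * csqrt (2 * parabolic_x \<gamma> q)" "b q = csqrt (2 * p) * csqrt (2 * parabolic_y \<gamma> q)"
      by (simp_all add: a_def b_def parabolic_s_def)
  qed
  show "(a q / 2)\<^sup>2 = p * parabolic_x \<gamma> q" "(b q / 2)\<^sup>2 = p * parabolic_y \<gamma> q"
    by (simp_all add: a b power_mult_distrib power_divide)
  have "a q * b q = (csqrt (2 * p))\<^sup>2 * (csqrt (2 * parabolic_x \<gamma> q) * csqrt (2 * parabolic_y \<gamma> q))"
    by (simp only: a b power2_eq_square mult_ac)
  thus ab: "a q * b q = 2 * p * of_real \<gamma>"
    unfolding csqrt_parabolic_mult[OF q \<gamma>] by simp
  have "a q * b q \<noteq> 0" using p \<gamma> unfolding ab by auto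
  thus "a q \<noteq> 0" "b q \<noteq> 0" by auto
  show "b q = csqrt (2 * p) * csqrt (2 * parabolic_y \<gamma> q)" by (rule b)
qed

lemma bessel_K_values:
  assumes q: "Re q > 0"
  shows "Bessel_K 0 (b q) = macdonald_integral 0 p (parabolic_y \<gamma> q) / 2"
    "Bessel_K 1 (b q) = b q / (4 * parabolic_y \<gamma> q) * macdonald_integral 1 p (parabolic_y \<gamma> q)"
  using Bessel_K_0_eq_macdonald_integral[OF p Re_parabolic_y[OF q]] 
    Bessel_K_1_eq_macdonald_integral[OF p Re_parabolic_y[OF q]]
  by (simp_all add: bessel_arguments(6)[OF q])

text \<open>
  Both square roots disappear: they enter only through \<open>a b = 2p\<gamma>\<close>.
\<close>

lemma J1_K1_eq_bessel_transform:
  assumes q: "Re q > 0"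
  shows "Bessel_J 1 (a q) * Bessel_K 1 (b q) = bessel_transform p \<gamma> 1 0 q / 2"
proof -
  note * = bessel_arguments[OF q]
  have y: "parabolic_y \<gamma> q \<noteq> 0" using Re_parabolic_y[OF q, of \<gamma>] by auto
  have rec: "p * macdonald_integral 1 p (parabolic_y \<gamma> q) = parabolic_y \<gamma> q * macdonald_integral (- 1) p (parabolic_y \<gamma> q)"
    using macdonald_integral_recurrence[OF p Re_parabolic_y[OF q], of 0] by simp
  have "Bessel_J 1 (a q) * Bessel_K 1 (b q) =
     (a q * b q) * bessel_clifford 1 (- (p * parabolic_x \<gamma> q)) * macdonald_integral 1 p (parabolic_y \<gamma> q) / (8 * parabolic_y \<gamma> q)"
    unfolding Bessel_J_1 bessel_K_values[OF q] *(1) by simp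
  also have "\<dots> = of_real \<gamma> * bessel_clifford 1 (- (p * parabolic_x \<gamma> q)) * (p * macdonald_integral 1 p (parabolic_y \<gamma> q)) / (4 * parabolic_y \<gamma> q)"
    unfolding *(3) by simp
  also have "\<dots> = of_real \<gamma> * bessel_clifford 1 (- (p * parabolic_x \<gamma> q)) * macdonald_integral (- 1) p (parabolic_y \<gamma> q) / 4"
    unfolding rec using y by simp
  also have "\<dots> = bessel_transform p \<gamma> 1 0 q / 2"
    using bessel_transform_eq_product[of 1 \<gamma> p q] p q \<gamma> by simp
  finally show ?thesis .
qed

text \<open>
  With \<open>E\<^sub>\<nu> = bessel_clifford \<nu> (- px)\<close> and \<open>M\<^sub>\<mu> = macdonald_integral \<mu> p y\<close>, the combination is
  \<open>F = (x E\<^sub>1 M\<^sub>0 + E\<^sub>0 M\<^sub>1)/(2\<gamma>)\<close>.  Since \<open>x' = - x/s\<close> and \<open>y' = y/s\<close>, its derivative contains the terms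
  \<open>E\<^sub>1 (p M\<^sub>1 - y M\<^bsub>-1\<^esub>)\<close>, which cancel, and leaves the single product \<open>- E\<^sub>0 M\<^sub>0 (x + y)/(2\<gamma>s)\<close> with
  \<open>x + y = s\<close>.  The transform on the right has integrand \<open>t\<^bsup>-1\<^esup> e\<^bsup>-qt-p/t\<^esup> J\<^sub>0(\<gamma>t)\<close>, and two more derivatives turn
  \<open>t\<^bsup>-1\<^esup>\<close> into the \<open>t\<close> of the Mathieu integral: hence the third derivative of \<open>F\<close>.
\<close>

lemma has_field_derivative_J_K_combination:
  defines "F \<equiv> \<lambda>q. Bessel_J 1 (a q) * Bessel_K 0 (b q) / b q + Bessel_J 0 (a q) * Bessel_K 1 (b q) / a q"
  assumes q: "Re q > 0"
  shows "(F has_field_derivative - bessel_transform p \<gamma> 0 0 q / (2 * of_real \<gamma>)) (at q)"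
proof -
  define H where "H = (\<lambda>q. (parabolic_x \<gamma> q * bessel_clifford 1 (- (p * parabolic_x \<gamma> q)) * macdonald_integral 0 p (parabolic_y \<gamma> q)
      + bessel_clifford 0 (- (p * parabolic_x \<gamma> q)) * macdonald_integral 1 p (parabolic_y \<gamma> q)) / (2 * of_real \<gamma>))"
  have FH: "F q = H q" if q: "Re q > 0" for q
  proof -
    note * = bessel_arguments[OF q]
    have pnz: "p \<noteq> 0" "parabolic_y \<gamma> q \<noteq> 0" using p Re_parabolic_y[OF q, of \<gamma>] by auto
    define A B X Y where "A = a q" and "B = b q" and "X = parabolic_x \<gamma> q" and "Y = parabolic_y \<gamma> q"
    have nz: "A \<noteq> 0" "B \<noteq> 0" "p \<noteq> 0" "Y \<noteq> 0" "of_real \<gamma> \<noteq> (0::complex)"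
      using * pnz \<gamma> by (auto simp: A_def B_def Y_def)
    have X: "A / B = 2 * X / of_real \<gamma>"
    proof -
      have "A * of_real \<gamma> * (2 * p) = A * A * B" using *(3) by (simp add: A_def B_def mult_ac)
      also have "A * A = 4 * (p * X)" using *(1) by (simp add: A_def X_def power2_eq_square)
      finally show ?thesis using nz by (simp add: field_simps)
    qed
    have Y: "B / A = 2 * Y / of_real \<gamma>"
    proof -
      have "B * of_real \<gamma> * (2 * p) = B * B * A" using *(3) by (simp add: A_def B_def mult_ac)
      also have "B * B = 4 * (p * Y)" using *(2) by (simp add: B_def Y_def power2_eq_square)
      finally show ?thesis using nz by (simp add: field_simps)
    qed
    have "F q = (A / B) * bessel_clifford 1 (- (p * X)) * macdonald_integral 0 p Y / 4
           + (B / A) * bessel_clifford 0 (- (p * X)) * macdonald_integral 1 p Y / (4 * Y)"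
      unfolding F_def bessel_K_values[OF q] Bessel_J_0 Bessel_J_1 *(1)
      by (simp add: A_def B_def X_def Y_def mult_ac)
    also have "\<dots> = H q"
      unfolding X Y H_def X_def[symmetric] Y_def[symmetric] using nz by (simp add: field_simps)
    finally show ?thesis .
  qed
  define X Y S where "X = parabolic_x \<gamma> q" and "Y = parabolic_y \<gamma> q" and "S = parabolic_s \<gamma> q"
  define E0 E1 E2 where "E0 = bessel_clifford 0 (- (p * X))" and "E1 = bessel_clifford 1 (- (p * X))"
    and "E2 = bessel_clifford 2 (- (p * X))"
  define M where "M = (\<lambda>\<mu>. macdonald_integral \<mu> p Y)"
  have S: "S \<noteq> 0" "X + Y = S" using Re_parabolic_s[OF q, of \<gamma>] parabolic_x_add_y[of \<gamma> q] by (auto simp: S_def X_def Y_def)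
  have E2: "E0 = - (p * X) * E2 + E1"
    using bessel_clifford_recurrence[of "- (p * X)" 1] by (simp add: E0_def E1_def E2_def)
  have M1: "p * M 1 = Y * M (- 1)"
    using macdonald_integral_recurrence[OF p Re_parabolic_y[OF q], of 0] by (simp add: M_def Y_def)
  have "(H has_field_derivative
     ((((- X / S) * E1 + (E2 * - (p * (- X / S))) * X) * M 0 + (- M (0 - 1) * (Y / S)) * (X * E1))
      + ((E1 * - (p * (- X / S))) * M 1 + (- M (1 - 1) * (Y / S)) * E0)) / (2 * of_real \<gamma>)) (at q)"
    unfolding H_def X_def Y_def S_def E0_def E1_def E2_def M_def
    using has_field_derivative_bessel_clifford[of 0] has_field_derivative_bessel_clifford[of 1]
    by (intro DERIV_cdivide DERIV_add DERIV_mult DERIV_minus DERIV_cmult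
              DERIV_chain2[of "bessel_clifford 0"] DERIV_chain2[of "bessel_clifford 1"]
              DERIV_chain2[OF has_field_derivative_macdonald_integral] p Re_parabolic_y q
              has_field_derivative_parabolic_x has_field_derivative_parabolic_y) simp_all
  also have "(((- X / S) * E1 + (E2 * - (p * (- X / S))) * X) * M 0 + (- M (0 - 1) * (Y / S)) * (X * E1))
      + ((E1 * - (p * (- X / S))) * M 1 + (- M (1 - 1) * (Y / S)) * E0)
    = - ((X / S) * (- (p * X) * E2 + E1) * M 0) + (X / S) * E1 * (p * M 1 - Y * M (- 1)) - (Y / S) * E0 * M 0"
    by (simp add: algebra_simps)
  also have "\<dots> = - ((X + Y) / S * E0 * M 0)"
    unfolding E2[symmetric] M1 by (simp add: algebra_simps add_divide_distrib)
  also have "\<dots> = - bessel_transform p \<gamma> 0 0 q"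
    using S bessel_transform_eq_product[of 0 \<gamma> p q] p q \<gamma> by (simp add: E0_def M_def X_def Y_def)
  finally have "(H has_field_derivative - bessel_transform p \<gamma> 0 0 q / (2 * of_real \<gamma>)) (at q)" .
  thus ?thesis
    by (rule has_field_derivative_transform_within_open[OF _ open_halfspace_Re_gt[of 0]])
       (use q FH in auto)
qed

end

lemma deriv_eq_on_open:
  assumes "\<And>z. z \<in> S \<Longrightarrow> f z = g z" "open S" "z \<in> S" "(g has_field_derivative d) (at z)"
  shows "deriv f z = d"
proof -
  have "(f has_field_derivative d) (at z)"
    by (rule has_field_derivative_transform_within_open[OF assms(4,2,3)]) (simp add: assms(1))
  thus ?thesis by (rule DERIV_imp_deriv)
qed

lemma ext_Mathieu_half:
  assumes "\<gamma> > 0"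
  shows "ext_Mathieu (1/2) p \<gamma> = 2 * (\<integral>t. bessel_kernel p \<gamma> 0 2 t / of_real (exp t - 1) \<partial>pos_lborel)"
proof -
  have G: "Gamma (1 / 2 + 1 :: real) = sqrt pi / 2"
    by (subst Gamma_plus1) (auto simp: Gamma_one_half_real elim!: nonpos_Ints_cases)
  have "(LINT t:{0<..}|lborel. of_real (t powr (1/2 + 1/2)) * exp (- p / of_real t) / of_real (exp t - 1) *
        Bessel_J (1/2 - 1/2) (of_real (\<gamma> * t))) = (\<integral>t. bessel_kernel p \<gamma> 0 2 t / of_real (exp t - 1) \<partial>pos_lborel)"
    unfolding integral_pos_lborel[symmetric]
    by (rule integral_pos_lborel_cong) (simp add: bessel_kernel_def power2_eq_square)
  thus ?thesis using assms unfolding ext_Mathieu_def G by simp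
qed

lemma ext_Mathieu_minus_half:
  assumes "\<gamma> > 0"
  shows "ext_Mathieu (-1/2) p \<gamma> = 2 * of_real \<gamma> * (\<integral>t. bessel_kernel p \<gamma> 1 1 t / of_real (exp t - 1) \<partial>pos_lborel)"
proof -
  have "(LINT t:{0<..}|lborel. of_real (t powr (- 1/2 + 1/2)) * exp (- p / of_real t) / of_real (exp t - 1) *
        Bessel_J (- 1/2 - 1/2) (of_real (\<gamma> * t))) = (\<integral>t. bessel_kernel p \<gamma> 1 1 t / of_real (exp t - 1) \<partial>pos_lborel)"
    unfolding integral_pos_lborel[symmetric]
    by (rule integral_pos_lborel_cong) (simp add: bessel_kernel_def Bessel_J_minus_1)
  moreover have "sqrt pi / ((2 * \<gamma>) powr (- 1/2 - 1/2) * Gamma (- 1/2 + 1)) = 2 * \<gamma>"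
    using assms by (simp add: Gamma_one_half_real powr_minus inverse_eq_divide)
  ultimately show ?thesis unfolding ext_Mathieu_def by simp
qed

theorem theorem2:
  fixes p :: complex and \<gamma> :: real
  assumes "Re p > 0" and "\<gamma> > 0"
  shows
    "let a = (\<lambda>q::complex. csqrt (2 * p) * csqrt (csqrt (q\<^sup>2 + (of_real \<gamma>)\<^sup>2) - q));
         b = (\<lambda>q::complex. csqrt (2 * p) * csqrt (csqrt (q\<^sup>2 + (of_real \<gamma>)\<^sup>2) + q));
         F = (\<lambda>q. Bessel_J 1 (a q) * Bessel_K 0 (b q) / b q + Bessel_J 0 (a q) * Bessel_K 1 (b q) / a q);
         G = (\<lambda>q. Bessel_J 1 (a q) * Bessel_K 1 (b q))
     in (summable (\<lambda>k. (deriv ^^ 3) F (of_nat (Suc k))) \<and>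
         ext_Mathieu (1/2) p \<gamma> = - 4 * of_real \<gamma> * (\<Sum>k. (deriv ^^ 3) F (of_nat (Suc k)))) \<and>
        (summable (\<lambda>k. deriv G (of_nat (Suc k))) \<and>
         ext_Mathieu (-1/2) p \<gamma> = 4 * of_real \<gamma> * (\<Sum>k. deriv G (of_nat (Suc k))))"
proof -
  define a where "a = (\<lambda>q::complex. csqrt (2 * p) * csqrt (csqrt (q\<^sup>2 + (of_real \<gamma>)\<^sup>2) - q))"
  define b where "b = (\<lambda>q::complex. csqrt (2 * p) * csqrt (csqrt (q\<^sup>2 + (of_real \<gamma>)\<^sup>2) + q))"
  define F where "F = (\<lambda>q. Bessel_J 1 (a q) * Bessel_K 0 (b q) / b q + Bessel_J 0 (a q) * Bessel_K 1 (b q) / a q)"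
  define G where "G = (\<lambda>q. Bessel_J 1 (a q) * Bessel_K 1 (b q))"
  let ?H = "{q. Re q > 0}"
  note op = open_halfspace_Re_gt[of 0]
  have T': "(bessel_transform p \<gamma> \<nu> m has_field_derivative bessel_transform p \<gamma> \<nu> (Suc m) q) (at q)"
    if "\<nu> \<in> {0, 1}" "q \<in> ?H" for \<nu> m q
    using has_field_derivative_bessel_transform[of \<nu> \<gamma> p q m] that assms by auto
  have F': "deriv F q = - bessel_transform p \<gamma> 0 0 q / (2 * of_real \<gamma>)" if "q \<in> ?H" for q
    unfolding F_def a_def b_def
    by (rule DERIV_imp_deriv[OF has_field_derivative_J_K_combination]) (use assms that in auto)
  have F'': "deriv (deriv F) q = - bessel_transform p \<gamma> 0 1 q / (2 * of_real \<gamma>)" if "q \<in> ?H" for q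
    by (rule deriv_eq_on_open[OF F' op that])
       (use T'[of 0 q 0] that in \<open>auto intro!: DERIV_cdivide DERIV_minus\<close>)
  have F''': "deriv (deriv (deriv F)) q = - bessel_transform p \<gamma> 0 2 q / (2 * of_real \<gamma>)" if "q \<in> ?H" for q
    by (rule deriv_eq_on_open[OF F'' op that])
       (use T'[of 0 q 1] that in \<open>auto intro!: DERIV_cdivide DERIV_minus simp: numeral_2_eq_2\<close>)
  have F3: "(deriv ^^ 3) F (of_nat (Suc k)) = - bessel_transform p \<gamma> 0 2 (of_nat (Suc k)) / (2 * of_real \<gamma>)" for k
    using F'''[of "of_nat (Suc k)"] by (simp add: numeral_3_eq_3)
  have GT: "G q = bessel_transform p \<gamma> 1 0 q / 2" if "q \<in> ?H" for q
    unfolding G_def a_def b_def by (rule J1_K1_eq_bessel_transform) (use assms that in auto)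
  have G': "deriv G (of_nat (Suc k)) = bessel_transform p \<gamma> 1 1 (of_nat (Suc k)) / 2" for k
    by (rule deriv_eq_on_open[OF GT op])
       (use T'[of 1 "of_nat (Suc k)" 0] in \<open>auto intro!: DERIV_cdivide\<close>)
  define I J where "I = (\<integral>t. bessel_kernel p \<gamma> 0 2 t / of_real (exp t - 1) \<partial>pos_lborel)"
    and "J = (\<integral>t. bessel_kernel p \<gamma> 1 1 t / of_real (exp t - 1) \<partial>pos_lborel)"
  have 1: "(\<lambda>k. (deriv ^^ 3) F (of_nat (Suc k))) sums (- I / (2 * of_real \<gamma>))"
    unfolding F3 I_def by (intro sums_divide sums_minus sums_bessel_transform) (use assms in auto)
  have 2: "(\<lambda>k. deriv G (of_nat (Suc k))) sums (J / 2)"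
    unfolding G' J_def by (intro sums_divide sums_bessel_transform) (use assms in auto)
  have "ext_Mathieu (1/2) p \<gamma> = - 4 * of_real \<gamma> * (- I / (2 * of_real \<gamma>))"
    "ext_Mathieu (-1/2) p \<gamma> = 4 * of_real \<gamma> * (J / 2)"
    unfolding I_def J_def using assms ext_Mathieu_half[of \<gamma> p] ext_Mathieu_minus_half[of \<gamma> p]
    by simp_all
  hence "(summable (\<lambda>k. (deriv ^^ 3) F (of_nat (Suc k))) \<and>
         ext_Mathieu (1/2) p \<gamma> = - 4 * of_real \<gamma> * (\<Sum>k. (deriv ^^ 3) F (of_nat (Suc k)))) \<and>
        (summable (\<lambda>k. deriv G (of_nat (Suc k))) \<and>
         ext_Mathieu (-1/2) p \<gamma> = 4 * of_real \<gamma> * (\<Sum>k. deriv G (of_nat (Suc k))))"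
    unfolding sums_unique[OF 1, symmetric] sums_unique[OF 2, symmetric]
    using sums_summable[OF 1] sums_summable[OF 2] by (intro conjI)
  thus ?thesis unfolding Let_def F_def G_def a_def b_def .
qed

end
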